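(* Let $X=\{X_1,\ldots,X_m\}$ be a family of linearly independent smooth vector fields on $\mathbb{R}^n$ satisfying (H.1) and (H.2) (see context), let $\Omega\subseteq\mathbb{R}^n$ be a bounded open set, regular for the Divergence Theorem, and let $\mathcal{F}=\mathcal{F}(x,z,p,r):\Omega\times\mathbb{R}\times\mathbb{R}^m\times\mathbb{R}^{m^2}\to\mathbb{R}$, $r=\{r_{ij}\}_{i,j=1}^m$, satisfy (P.1), (P.2) and (P.3) (see context). Then for every $u\in C^4(\overline\Omega)$, $$ \begin{aligned} &\int_{\Omega}\big(q\,\mathcal{F}-\langle \mathcal{F}_p,\nabla_X u\rangle\big)\,dx+\int_{\Omega}\sum_{i=1}^n\sigma_i x_i\,(\partial_{x_i}\mathcal{F})\big(x,u,\nabla_X u,\mathcal{H}_Xu\big)\,dx\\ &\qquad+\int_{\Omega}\mathrm{T}u\,\Big(\mathrm{div}_X(\mathcal{F}_p)+\sum_{i,j=1}^mX_i\big(X_j(\mathcal{F}_{r_{ij}})\big)+\partial_z\mathcal{F}\Big)\,dx-2\sum_{i,j=1}^m\int_\Omega\mathcal{F}_{r_{ij}}\,X_j(X_iu)\,dx\\ &\quad=\int_{\partial\Omega}\mathcal{F}\,\langle \mathrm{T}(x),\nu\rangle\,dH^{n-1}-\int_{\partial\Omega}\mathrm{T}u\,\langle\mathcal{F}_p,\nu_X\rangle\,dH^{n-1}\\ &\qquad+\sum_{i,j=1}^m\int_{\partial\Omega}\big(X_i(\mathcal{F}_{r_{ji}})\,\mathrm{T}u-\mathcal{F}_{r_{ij}}\,X_i(\mathrm{T}u)\big)\,\langle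 X_j(x),\nu\rangle\,dH^{n-1}, \end{aligned} $$ where $\mathcal{F}$, $\partial_z\mathcal{F}$, $\mathcal{F}_p=(\partial_{p_1}\mathcal{F},\ldots,\partial_{p_m}\mathcal{F})$ and $\mathcal{F}_{r_{ij}}=\partial_{r_{ij}}\mathcal{F}$ are evaluated at $(x,u(x),\nabla_X u(x),\mathcal{H}_Xu(x))$, and $\mathrm{div}_X$, $X_i$, $X_j$ applied to them act on the resulting functions of $x$.
   Context: Assumptions on the vector fields. $X_1,\ldots,X_m$ are smooth vector fields on $\mathbb{R}^n$, linearly independent (as elements of the real vector space of smooth vector fields), such that: (H.1) $X_1,\ldots,X_m$ are homogeneous of degree $1$ with respect to a family of dilations $\delta_\lambda(x)=(\lambda^{\sigma_1}x_1,\ldots,\lambda^{\sigma_n}x_n)$, $\lambda>0$, where $\sigma_1,\ldots,\sigma_n\in\mathbb{N}$ and $1=\sigma_1\le\cdots\le\sigma_n$; that is, $X_i(u\circ\delta_\lambda)=\lambda\,(X_iu)\circ\delta_\lambda$ for all $u\in C^\infty(\mathbb{R}^n)$, $\lambda>0$ and $i=1,\ldots,m$. (H.2) Hörmander's condition at $0$: $\dim\{Y(0):Y\in\mathrm{Lie}(X)\}=n$, where $\mathrm{Lie}(X)$ is the smallest Lie subalgebra of the smooth vector fields on $\mathbb{R}^n$ containing $X$. For a vector field $Y=\sum_i a_i(x)\partial_{x_i}$, $Y(x)$ denotes the vector $(a_1(x),\ldots,a_n(x))\in\mathbb{R}^n$. Notation. $q:=\sum_{k=1}^n\sigma_k$.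 $\mathrm{T}:=\sum_{i=1}^n\sigma_i x_i\partial_{x_i}$, so $\mathrm{T}(x)=(\sigma_1x_1,\ldots,\sigma_nx_n)$. $\nabla_Xu=(X_1u,\ldots,X_mu)$. $\mathcal{H}_Xu:=\big(X_j(X_iu)\big)_{i,j=1}^m$ is the $X$-Hessian (in general not symmetric), and its $(i,j)$ entry $X_j(X_iu)$ is substituted for the variable $r_{ij}$. For $V=(V_1,\ldots,V_m)$ of class $C^1$, $\mathrm{div}_XV:=-\sum_{i=1}^mX_iV_i$ (note the minus sign). $H^{n-1}$ is the $(n-1)$-dimensional Hausdorff measure, $\nu$ is the outward unit normal to $\partial\Omega$, and $\nu_X:=(\langle X_1(x),\nu\rangle,\ldots,\langle X_m(x),\nu\rangle)$. "Regular for the Divergence Theorem" has its usual meaning: $H^{n-1}(\partial\Omega)<\infty$, the outward unit normal $\nu$ is defined $H^{n-1}$-a.e. on $\partial\Omega$, and $\int_\Omega\mathrm{div}\,V\,dx=\int_{\partial\Omega}\langle V,\nu\rangle\,dH^{n-1}$ for all $V\in C^1(\overline\Omega;\mathbb{R}^n)$. Assumptions on $\mathcal{F}$, with $\mathcal{O}:=\Omega\times\mathbb{R}\times\mathbb{R}^m\times\mathbb{R}^{m^2}$: (P.1) $\mathcal{F}$ is of class $C^1$ on (an open neighborhood of) $\overline{\mathcal{O}}$; (P.2) for every $i=1,\ldots,m$, $\partial_{p_i}\mathcal{F}$ is of class $C^1$ on $\overline{\mathcal{O}}$; (P.3) for every $i,j=1,\ldots,m$, $\partial_{r_{ij}}\mathcal{F}$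 is of class $C^2$ on $\overline{\mathcal{O}}$. *)

theory Defs
  imports "HOL-Analysis.Analysis"
begin

section \<open>Functions of class \<open>C\<^sup>k\<close>\<close>

primrec Ck_on :: "nat \<Rightarrow> 'a::euclidean_space set \<Rightarrow> ('a \<Rightarrow> real) \<Rightarrow> bool" where
  "Ck_on 0 U f = continuous_on U f"
| "Ck_on (Suc k) U f =
    ((\<forall>x\<in>U. f differentiable at x) \<and>
     (\<forall>b\<in>Basis. Ck_on k U (\<lambda>x. frechet_derivative f (at x) b)))"

definition smooth :: "('a::euclidean_space \<Rightarrow> real) \<Rightarrow> bool" where
  "smooth f \<longleftrightarrow> (\<forall>k. Ck_on k UNIV f)"

text \<open>
  Derivative in direction \<open>b\<close> of a function on the closure of an open set \<open>\<Omega>\<close>: the ordinary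
  derivative inside \<open>\<Omega>\<close>, and its limit from inside \<open>\<Omega>\<close> at the boundary points.
  For \<open>\<Omega> = UNIV\<close> it is the ordinary derivative.
\<close>

definition dderiv :: "'a::euclidean_space set \<Rightarrow> 'a \<Rightarrow> ('a \<Rightarrow> real) \<Rightarrow> 'a \<Rightarrow> real" where
  "dderiv \<Omega> b f x =
    (if x \<in> \<Omega> then frechet_derivative f (at x) b
     else Lim (at x within \<Omega>) (\<lambda>y. frechet_derivative f (at y) b))"

text \<open>
  \<open>C\<^sup>k\<close> up to the boundary: \<open>f\<close> is \<open>C\<^sup>k\<close> in the open set \<open>\<Omega>\<close> and all its derivatives of order at
  most \<open>k\<close> extend continuously to the closure of \<open>\<Omega>\<close>.
\<close>

primrec Ck_closure :: "nat \<Rightarrow> 'a::euclidean_space set \<Rightarrow> ('a \<Rightarrow> real) \<Rightarrow> bool" where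
  "Ck_closure 0 \<Omega> f = continuous_on (closure \<Omega>) f"
| "Ck_closure (Suc k) \<Omega> f =
    (continuous_on (closure \<Omega>) f \<and> (\<forall>x\<in>\<Omega>. f differentiable at x) \<and>
     (\<forall>b\<in>Basis. Ck_closure k \<Omega> (dderiv \<Omega> b f)))"


section \<open>Vector fields\<close>

definition smooth_vf :: "(real^'n \<Rightarrow> real^'n) \<Rightarrow> bool" where
  "smooth_vf Y \<longleftrightarrow> (\<forall>k. smooth (\<lambda>x. Y x $ k))"

text \<open>
  The vector field \<open>Y\<close> as a first order differential operator, acting on functions on the closure
  of \<open>\<Omega>\<close>; \<open>\<Omega> = UNIV\<close> gives the action on functions on the whole space.
\<close>

definition vf_app :: "(real^'n) set \<Rightarrow> (real^'n \<Rightarrow> real^'n) \<Rightarrow> (real^'n \<Rightarrow> real) \<Rightarrow> real^'n \<Rightarrow> real" where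
  "vf_app \<Omega> Y u x = (\<Sum>k\<in>UNIV. Y x $ k * dderiv \<Omega> (axis k 1) u x)"

definition vf_lin_indep :: "('m::finite \<Rightarrow> real^'n \<Rightarrow> real^'n) \<Rightarrow> bool" where
  "vf_lin_indep X \<longleftrightarrow>
    (\<forall>c::'m \<Rightarrow> real. (\<forall>x. (\<Sum>i\<in>UNIV. c i *\<^sub>R X i x) = 0) \<longrightarrow> (\<forall>i. c i = 0))"

definition vf_bracket :: "(real^'n \<Rightarrow> real^'n) \<Rightarrow> (real^'n \<Rightarrow> real^'n) \<Rightarrow> real^'n \<Rightarrow> real^'n" where
  "vf_bracket Y Z x =
    (\<chi> k. vf_app UNIV Y (\<lambda>y. Z y $ k) x - vf_app UNIV Z (\<lambda>y. Y y $ k) x)"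

definition vf_lie_subalgebra :: "(real^'n \<Rightarrow> real^'n) set \<Rightarrow> bool" where
  "vf_lie_subalgebra L \<longleftrightarrow>
    L \<subseteq> Collect smooth_vf \<and>
    (\<lambda>x. 0) \<in> L \<and>
    (\<forall>Y\<in>L. \<forall>Z\<in>L. (\<lambda>x. Y x + Z x) \<in> L) \<and>
    (\<forall>c. \<forall>Y\<in>L. (\<lambda>x. c *\<^sub>R Y x) \<in> L) \<and>
    (\<forall>Y\<in>L. \<forall>Z\<in>L. vf_bracket Y Z \<in> L)"

definition generated_lie_algebra :: "('m \<Rightarrow> real^'n \<Rightarrow> real^'n) \<Rightarrow> (real^'n \<Rightarrow> real^'n) set" where
  "generated_lie_algebra X = vf_lie_subalgebra hull (range X)"

definition dilation :: "('n \<Rightarrow> nat) \<Rightarrow> real \<Rightarrow> real^'n \<Rightarrow> real^'n" where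
  "dilation \<sigma> t x = (\<chi> k. t ^ \<sigma> k * x $ k)"

text \<open>
  The coordinates are indexed by a finite linearly ordered type; \<open>Min UNIV\<close> is the first index.
\<close>

definition dilation_exponents :: "('n::{finite,linorder} \<Rightarrow> nat) \<Rightarrow> bool" where
  "dilation_exponents \<sigma> \<longleftrightarrow> mono \<sigma> \<and> \<sigma> (Min UNIV) = 1"

definition homogeneous_vfs :: "('n \<Rightarrow> nat) \<Rightarrow> ('m \<Rightarrow> real^'n \<Rightarrow> real^'n) \<Rightarrow> bool" where
  "homogeneous_vfs \<sigma> X \<longleftrightarrow>
    (\<forall>i u t. smooth u \<longrightarrow> t > 0 \<longrightarrow>
      vf_app UNIV (X i) (u \<circ> dilation \<sigma> t) = (\<lambda>x. t * (vf_app UNIV (X i) u \<circ> dilation \<sigma> t) x))"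

definition hoermander_at_0 :: "('m \<Rightarrow> real^'n \<Rightarrow> real^'n) \<Rightarrow> bool" where
  "hoermander_at_0 (X :: 'm \<Rightarrow> real^'n \<Rightarrow> real^'n) \<longleftrightarrow>
    dim {Y 0 | Y. Y \<in> generated_lie_algebra X} = CARD('n)"

definition euler_vf :: "('n \<Rightarrow> nat) \<Rightarrow> real^'n \<Rightarrow> real^'n" where
  "euler_vf \<sigma> x = (\<chi> k. real (\<sigma> k) * x $ k)"

definition X_grad ::
  "(real^'n) set \<Rightarrow> ('m \<Rightarrow> real^'n \<Rightarrow> real^'n) \<Rightarrow> (real^'n \<Rightarrow> real) \<Rightarrow> real^'n \<Rightarrow> real^'m" where
  "X_grad \<Omega> X u x = (\<chi> i. vf_app \<Omega> (X i) u x)"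

text \<open>The entry with index \<open>(i, j)\<close> is \<open>X\<^sub>j (X\<^sub>i u)\<close>, in this order.\<close>

definition X_hessian ::
  "(real^'n) set \<Rightarrow> ('m \<Rightarrow> real^'n \<Rightarrow> real^'n) \<Rightarrow> (real^'n \<Rightarrow> real) \<Rightarrow> real^'n \<Rightarrow> real^'m^'m" where
  "X_hessian \<Omega> X u x = (\<chi> i j. vf_app \<Omega> (X j) (vf_app \<Omega> (X i) u) x)"

text \<open>With a minus sign: \<open>- X\<^sub>i\<close> is the formal adjoint of the divergence-free field \<open>X\<^sub>i\<close>.\<close>

definition X_div ::
  "(real^'n) set \<Rightarrow> ('m::finite \<Rightarrow> real^'n \<Rightarrow> real^'n) \<Rightarrow> (real^'n \<Rightarrow> real^'m) \<Rightarrow> real^'n \<Rightarrow> real" where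
  "X_div \<Omega> X V x = - (\<Sum>i\<in>UNIV. vf_app \<Omega> (X i) (\<lambda>y. V y $ i) x)"

definition X_normal ::
  "('m \<Rightarrow> real^'n \<Rightarrow> real^'n) \<Rightarrow> (real^'n \<Rightarrow> real^'n) \<Rightarrow> real^'n \<Rightarrow> real^'m" where
  "X_normal X \<nu> x = (\<chi> i. X i x \<bullet> \<nu> x)"


section \<open>Hausdorff measure, outward normal and the divergence theorem\<close>

text \<open>
  The \<open>d\<close>-dimensional Hausdorff outer measure, normalised by the volume of the unit ball of
  dimension \<open>d\<close>. Empty covering sets are treated separately because \<open>0 ^ 0 = 1\<close>, and coverings
  are restricted to bounded sets because \<^const>\<open>diameter\<close> is unspecified on unbounded ones.
\<close>

definition hausdorff_outer :: "nat \<Rightarrow> 'a::metric_space set \<Rightarrow> ennreal" where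
  "hausdorff_outer d A =
    (SUP \<delta>\<in>{0<..}. INF C\<in>{C :: nat \<Rightarrow> 'a set. A \<subseteq> (\<Union>j. C j) \<and> (\<forall>j. bounded (C j) \<and> diameter (C j) \<le> \<delta>)}.
      (\<Sum>j. if C j = {} then 0 else ennreal (unit_ball_vol (real d) * (diameter (C j) / 2) ^ d)))"

text \<open>The restriction to the sets that are measurable in the sense of Caratheodory.\<close>

definition hausdorff_measure :: "nat \<Rightarrow> 'a::metric_space measure" where
  "hausdorff_measure d =
    measure_of UNIV (lambda_system UNIV (Pow UNIV) (hausdorff_outer d)) (hausdorff_outer d)"

text \<open>
  The (measure-theoretic) outward unit normal of Federer: near \<open>x\<close>, the set \<open>\<Omega>\<close> is asymptotically
  the half-space \<open>(y - x) \<bullet> \<nu> < 0\<close>. There is at most one such \<open>\<nu>\<close>, and it is the classical outward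
  unit normal wherever the boundary has one.
\<close>

definition is_outward_normal :: "(real^'n) set \<Rightarrow> real^'n \<Rightarrow> real^'n \<Rightarrow> bool" where
  "is_outward_normal (\<Omega> :: (real^'n) set) x \<nu> \<longleftrightarrow>
    norm \<nu> = 1 \<and>
    ((\<lambda>r. measure lborel {y \<in> ball x r \<inter> \<Omega>. (y - x) \<bullet> \<nu> > 0} / r ^ CARD('n)) \<longlongrightarrow> 0) (at_right 0) \<and>
    ((\<lambda>r. measure lborel {y \<in> ball x r - \<Omega>. (y - x) \<bullet> \<nu> < 0} / r ^ CARD('n)) \<longlongrightarrow> 0) (at_right 0)"

definition outward_normal :: "(real^'n) set \<Rightarrow> real^'n \<Rightarrow> real^'n" where
  "outward_normal \<Omega> x = (SOME \<nu>. is_outward_normal \<Omega> x \<nu>)"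

definition regular_for_divergence_theorem :: "(real^'n) set \<Rightarrow> bool" where
  "regular_for_divergence_theorem (\<Omega> :: (real^'n) set) \<longleftrightarrow>
    emeasure (hausdorff_measure (CARD('n) - 1)) (frontier \<Omega>) < \<infinity> \<and>
    (AE x in hausdorff_measure (CARD('n) - 1). x \<in> frontier \<Omega> \<longrightarrow> (\<exists>\<nu>. is_outward_normal \<Omega> x \<nu>)) \<and>
    (\<forall>V :: real^'n \<Rightarrow> real^'n. (\<forall>k. Ck_closure 1 \<Omega> (\<lambda>x. V x $ k)) \<longrightarrow>
      set_integrable (hausdorff_measure (CARD('n) - 1)) (frontier \<Omega>)
        (\<lambda>x. V x \<bullet> outward_normal \<Omega> x) \<and>
      (LINT x:\<Omega>|lborel. (\<Sum>k\<in>UNIV. dderiv \<Omega> (axis k 1) (\<lambda>y. V y $ k) x)) =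
      (LINT x:frontier \<Omega>|hausdorff_measure (CARD('n) - 1). V x \<bullet> outward_normal \<Omega> x))"


section \<open>The integrand\<close>

text \<open>
  Integrands are functions \<open>F (x, z, p, r)\<close> with \<open>r\<^sub>i\<^sub>j = r $ i $ j\<close>; they are total functions, of
  which only the values on a neighbourhood of the closure of the domain below matter.
\<close>

type_synonym ('n, 'm) jet = "(real^'n) \<times> real \<times> (real^'m) \<times> (real^'m^'m)"

definition jet_domain :: "(real^'n) set \<Rightarrow> ('n, 'm) jet set" where
  "jet_domain \<Omega> = \<Omega> \<times> UNIV \<times> UNIV \<times> UNIV"

definition F_x :: "(('n::finite, 'm::finite) jet \<Rightarrow> real) \<Rightarrow> 'n \<Rightarrow> ('n, 'm) jet \<Rightarrow> real" where
  "F_x F k w = frechet_derivative F (at w) (axis k 1, 0, 0, 0)"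

definition F_z :: "(('n::finite, 'm::finite) jet \<Rightarrow> real) \<Rightarrow> ('n, 'm) jet \<Rightarrow> real" where
  "F_z F w = frechet_derivative F (at w) (0, 1, 0, 0)"

definition F_p :: "(('n::finite, 'm::finite) jet \<Rightarrow> real) \<Rightarrow> ('n, 'm) jet \<Rightarrow> real^'m" where
  "F_p F w = (\<chi> i. frechet_derivative F (at w) (0, 0, axis i 1, 0))"

definition F_r :: "(('n::finite, 'm::finite) jet \<Rightarrow> real) \<Rightarrow> 'm \<Rightarrow> 'm \<Rightarrow> ('n, 'm) jet \<Rightarrow> real" where
  "F_r F i j w = frechet_derivative F (at w) (0, 0, 0, axis i (axis j 1))"

definition jet_of ::
  "(real^'n) set \<Rightarrow> ('m::finite \<Rightarrow> real^'n \<Rightarrow> real^'n) \<Rightarrow> (real^'n \<Rightarrow> real) \<Rightarrow> real^'n \<Rightarrow> ('n, 'm) jet" where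
  "jet_of \<Omega> X u x = (x, u x, X_grad \<Omega> X u x, X_hessian \<Omega> X u x)"

end

theory Submission
  imports Defs
begin

text \<open>
  The identity is the divergence theorem applied to the field
  \<open>F(J) T - (\<Sum>i. A\<^sub>i Tu X\<^sub>i) + (\<Sum>i j. (X\<^sub>i B\<^sub>j\<^sub>i Tu - B\<^sub>i\<^sub>j X\<^sub>i Tu) X\<^sub>j)\<close>,
  where \<open>J = (x, u, \<nabla>\<^sub>X u, H\<^sub>X u)\<close>, \<open>A\<^sub>i\<close> and \<open>B\<^sub>i\<^sub>j\<close> are the derivatives of \<open>F\<close> with respect to \<open>p\<^sub>i\<close> and
  \<open>r\<^sub>i\<^sub>j\<close> along \<open>J\<close>, and \<open>T\<close> is the Euler field of the dilations.

  Homogeneity of the \<open>X\<^sub>i\<close> enters twice. Firstly, the \<open>k\<close>-th coefficient of \<open>X\<^sub>i\<close> does not depend on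
  \<open>x\<^sub>k\<close>, so that \<open>X\<^sub>i\<close> is divergence-free (\<open>homogeneous_vfs_divergence_free\<close>) and
  \<open>div (f X\<^sub>i) = X\<^sub>i f\<close>. Secondly, \<open>[X\<^sub>i, T] = X\<^sub>i\<close> (\<open>homogeneous_vfs_bracket_euler\<close>), which gives
  \<open>T X\<^sub>i u = X\<^sub>i Tu - X\<^sub>i u\<close> and \<open>T X\<^sub>j X\<^sub>i u = X\<^sub>j X\<^sub>i Tu - 2 X\<^sub>j X\<^sub>i u\<close> (\<open>vf_app_commute_euler\<close>). Since \<open>T\<close> has
  divergence \<open>q\<close>, the chain rule along \<open>J\<close> (\<open>vf_app_jet\<close>) yields
  \<open>div (F(J) T) = q F + (\<Sum>k. \<sigma>\<^sub>k x\<^sub>k F\<^sub>x\<^sub>k) + F\<^sub>z Tu + (\<Sum>i. A\<^sub>i (X\<^sub>i Tu - X\<^sub>i u))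
    + (\<Sum>i j. B\<^sub>i\<^sub>j (X\<^sub>j X\<^sub>i Tu - 2 X\<^sub>j X\<^sub>i u))\<close>,
  and the other two fields integrate \<open>A\<^sub>i X\<^sub>i Tu\<close> by parts once and \<open>B\<^sub>i\<^sub>j X\<^sub>j X\<^sub>i Tu\<close> twice.

  The remaining work is regularity: the fields must be \<open>C\<^sup>1\<close> up to the boundary, where derivatives are
  limits from inside. For this, \<open>C\<^sup>k\<close> functions up to the boundary are shown to be closed under
  sums, products and composition (\<open>Ck_closure_compose\<close>).
\<close>

section \<open>Functions of class \<open>C\<^sup>k\<close> up to the boundary\<close>

lemma dderiv_inside: "x \<in> \<Omega> \<Longrightarrow> dderiv \<Omega> b f x = frechet_derivative f (at x) b"
  by (simp add: dderiv_def)

lemma dderiv_eqI: "(f has_derivative f') (at x) \<Longrightarrow> x \<in> \<Omega> \<Longrightarrow> dderiv \<Omega> b f x = f' b"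
  by (simp add: dderiv_def frechet_derivative_at[symmetric])

lemma dderiv_cong:
  assumes "open \<Omega>" and eq: "\<And>x. x \<in> \<Omega> \<Longrightarrow> f x = g x"
  shows "dderiv \<Omega> b f = dderiv \<Omega> b g"
proof
  fix x
  have fd: "frechet_derivative f (at y) = frechet_derivative g (at y)" if "y \<in> \<Omega>" for y
  proof -
    have "(f has_derivative h) (at y) \<longleftrightarrow> (g has_derivative h) (at y)" for h
      using has_derivative_transform_within_open[OF _ \<open>open \<Omega>\<close> that] eq by metis
    then show ?thesis by (simp add: frechet_derivative_def)
  qed
  have "Lim (at x within \<Omega>) (\<lambda>y. frechet_derivative f (at y) b) =
        Lim (at x within \<Omega>) (\<lambda>y. frechet_derivative g (at y) b)"
    by (rule Lim_cong) (auto simp: eventually_at_filter fd)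
  then show "dderiv \<Omega> b f x = dderiv \<Omega> b g x"
    by (simp add: dderiv_def fd)
qed

text \<open>
  A function that is continuous on the closure and equal to the derivative in \<open>\<Omega>\<close> is also equal to
  the boundary values that \<^const>\<open>dderiv\<close> defines as limits. No relation between \<open>f\<close> on the boundary
  and \<open>f\<close> in \<open>\<Omega>\<close> is needed.
\<close>

lemma dderiv_eq_on_closure:
  assumes cont: "continuous_on (closure \<Omega>) g"
    and eq: "\<And>x. x \<in> \<Omega> \<Longrightarrow> dderiv \<Omega> b f x = g x" and x: "x \<in> closure \<Omega>"
  shows "dderiv \<Omega> b f x = g x"
proof (cases "x \<in> \<Omega>")
  case False
  have "(g \<longlongrightarrow> g x) (at x within \<Omega>)"
    using cont x closure_subset by (meson continuous_on_def tendsto_within_subset)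
  then have "((\<lambda>y. frechet_derivative f (at y) b) \<longlongrightarrow> g x) (at x within \<Omega>)"
    by (rule Lim_transform_eventually)
       (auto simp: eventually_at_filter eq[symmetric] dderiv_inside)
  moreover have "at x within \<Omega> \<noteq> bot"
    using x False by (auto simp: closure_def trivial_limit_within)
  ultimately show ?thesis
    using False by (simp add: dderiv_def tendsto_Lim)
qed (use eq in simp)

lemma Ck_closure_continuous: "Ck_closure k \<Omega> f \<Longrightarrow> continuous_on (closure \<Omega>) f"
  by (cases k) auto

lemma Ck_closure_cong:
  assumes "open \<Omega>" and eq: "\<And>x. x \<in> closure \<Omega> \<Longrightarrow> f x = g x"
  shows "Ck_closure k \<Omega> f \<longleftrightarrow> Ck_closure k \<Omega> g"
proof (cases k)
  case 0
  then show ?thesis using eq by (simp cong: continuous_on_cong)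
next
  case (Suc l)
  have in_eq: "\<And>x. x \<in> \<Omega> \<Longrightarrow> f x = g x"
    using eq closure_subset by blast
  have "f differentiable at x \<longleftrightarrow> g differentiable at x" if "x \<in> \<Omega>" for x
    unfolding differentiable_def
    using has_derivative_transform_within_open[OF _ \<open>open \<Omega>\<close> that] in_eq by metis
  moreover have "dderiv \<Omega> b f = dderiv \<Omega> b g" for b
    using in_eq by (rule dderiv_cong[OF \<open>open \<Omega>\<close>])
  ultimately show ?thesis
    using eq Suc by (simp cong: continuous_on_cong)
qed

text \<open>
  The derivatives required by \<^const>\<open>Ck_closure\<close> need to be identified in \<open>\<Omega>\<close> only, with functions
  \<open>g b\<close> that are already known to be regular up to the boundary.
\<close>

lemma Ck_closure_SucI:
  assumes "open \<Omega>" "continuous_on (closure \<Omega>) f"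
    and "\<And>x. x \<in> \<Omega> \<Longrightarrow> f differentiable at x"
    and g: "\<And>b. b \<in> Basis \<Longrightarrow> Ck_closure k \<Omega> (g b)"
    and eq: "\<And>b x. b \<in> Basis \<Longrightarrow> x \<in> \<Omega> \<Longrightarrow> dderiv \<Omega> b f x = g b x"
  shows "Ck_closure (Suc k) \<Omega> f"
proof -
  have "Ck_closure k \<Omega> (dderiv \<Omega> b f)" if b: "b \<in> Basis" for b
  proof -
    have "\<And>x. x \<in> closure \<Omega> \<Longrightarrow> dderiv \<Omega> b f x = g b x"
      by (rule dderiv_eq_on_closure[OF Ck_closure_continuous[OF g[OF b]]]) (use eq b in auto)
    then show ?thesis
      using g[OF b] by (simp cong: Ck_closure_cong[OF \<open>open \<Omega>\<close>])
  qed
  then show ?thesis using assms by simp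
qed

lemma Ck_closure_SucD: "Ck_closure (Suc k) \<Omega> f \<Longrightarrow> Ck_closure k \<Omega> f"
proof (induction k arbitrary: f)
  case (Suc k)
  then show ?case by (metis Ck_closure.simps(2))
qed auto

lemma Ck_closure_const [simp]: "open \<Omega> \<Longrightarrow> Ck_closure k \<Omega> (\<lambda>x. c)"
proof (induction k arbitrary: c)
  case (Suc k)
  show ?case
    by (rule Ck_closure_SucI[where g = "\<lambda>b x. 0"]) (use Suc in \<open>auto simp: dderiv_inside\<close>)
qed simp

lemma Ck_closure_linear:
  assumes "open \<Omega>" and f: "bounded_linear f"
  shows "Ck_closure k \<Omega> f"
proof (cases k)
  case 0
  then show ?thesis using f by (simp add: linear_continuous_on)
next
  case (Suc l)
  have d: "(f has_derivative f) (at x)" for x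
    by (rule bounded_linear_imp_has_derivative[OF f])
  show ?thesis unfolding Suc
    by (rule Ck_closure_SucI[where g = "\<lambda>b x. f b"])
       (use assms d in \<open>auto simp: linear_continuous_on dderiv_eqI differentiable_def\<close>)
qed

lemma Ck_closure_add:
  assumes "open \<Omega>"
  shows "Ck_closure k \<Omega> f \<Longrightarrow> Ck_closure k \<Omega> g \<Longrightarrow> Ck_closure k \<Omega> (\<lambda>x. f x + g x)"
proof (induction k arbitrary: f g)
  case (Suc k)
  show ?case
  proof (rule Ck_closure_SucI[where g = "\<lambda>b x. dderiv \<Omega> b f x + dderiv \<Omega> b g x"])
    fix b x assume x: "x \<in> \<Omega>"
    have "((\<lambda>x. f x + g x) has_derivative
        (\<lambda>h. frechet_derivative f (at x) h + frechet_derivative g (at x) h)) (at x)"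
      using Suc.prems x by (intro has_derivative_add) (auto simp: frechet_derivative_works)
    then show "dderiv \<Omega> b (\<lambda>x. f x + g x) x = dderiv \<Omega> b f x + dderiv \<Omega> b g x"
      using x by (simp add: dderiv_eqI dderiv_inside[of _ _ _ f] dderiv_inside[of _ _ _ g])
  qed (use Suc assms in \<open>auto intro!: continuous_intros\<close>)
qed (auto intro!: continuous_intros)

lemma Ck_closure_mult:
  assumes "open \<Omega>"
  shows "Ck_closure k \<Omega> f \<Longrightarrow> Ck_closure k \<Omega> g \<Longrightarrow> Ck_closure k \<Omega> (\<lambda>x. f x * g x)"
proof (induction k arbitrary: f g)
  case (Suc k)
  show ?case
  proof (rule Ck_closure_SucI[where g = "\<lambda>b x. f x * dderiv \<Omega> b g x + dderiv \<Omega> b f x * g x"])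
    fix b x assume x: "x \<in> \<Omega>"
    have "((\<lambda>x. f x * g x) has_derivative
        (\<lambda>h. f x * frechet_derivative g (at x) h + frechet_derivative f (at x) h * g x)) (at x)"
      using Suc.prems x by (intro has_derivative_mult) (auto simp: frechet_derivative_works)
    then show "dderiv \<Omega> b (\<lambda>x. f x * g x) x = f x * dderiv \<Omega> b g x + dderiv \<Omega> b f x * g x"
      using x by (simp add: dderiv_eqI dderiv_inside[of _ _ _ f] dderiv_inside[of _ _ _ g])
  next
    fix b :: 'a assume "b \<in> Basis"
    then show "Ck_closure k \<Omega> (\<lambda>x. f x * dderiv \<Omega> b g x + dderiv \<Omega> b f x * g x)"
      using Suc.prems
      by (intro Ck_closure_add[OF assms] Suc.IH) (auto intro: Ck_closure_SucD)
  qed (use Suc assms in \<open>auto intro!: continuous_intros derivative_intros\<close>)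
qed (auto intro!: continuous_intros)

lemma Ck_closure_sum:
  "open \<Omega> \<Longrightarrow> (\<And>i. i \<in> I \<Longrightarrow> Ck_closure k \<Omega> (f i)) \<Longrightarrow> Ck_closure k \<Omega> (\<lambda>x. \<Sum>i\<in>I. f i x)"
  by (induction I rule: infinite_finite_induct) (auto intro: Ck_closure_add)

lemma Ck_closure_diff:
  assumes "open \<Omega>" "Ck_closure k \<Omega> f" "Ck_closure k \<Omega> g"
  shows "Ck_closure k \<Omega> (\<lambda>x. f x - g x)"
  using Ck_closure_add[OF assms(1,2) Ck_closure_mult[OF assms(1) Ck_closure_const[of _ k "- 1"] assms(3)]]
    assms(1) by simp

lemma continuous_on_componentwise_inner:
  fixes J :: "'a::t2_space \<Rightarrow> 'b::euclidean_space"
  shows "(\<And>c. c \<in> Basis \<Longrightarrow> continuous_on S (\<lambda>x. J x \<bullet> c)) \<Longrightarrow> continuous_on S J"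
  using continuous_on_componentwise[of S J] by auto

text \<open>
  Composition with a vector-valued map \<open>J\<close>. By continuity \<open>J\<close> maps the closure of \<open>\<Omega>\<close> into the
  closure of \<open>D\<close>, so that the boundary values of the derivatives of \<open>f\<close> may be inserted in the
  chain rule.
\<close>

lemma Ck_closure_compose:
  fixes J :: "'a::euclidean_space \<Rightarrow> 'b::euclidean_space"
  assumes "open \<Omega>" "open D" and maps: "J ` \<Omega> \<subseteq> D"
  shows "Ck_closure k D f \<Longrightarrow> (\<And>c. c \<in> Basis \<Longrightarrow> Ck_closure k \<Omega> (\<lambda>x. J x \<bullet> c))
    \<Longrightarrow> Ck_closure k \<Omega> (\<lambda>x. f (J x))"
proof (induction k arbitrary: f)
  case k: 0
  have J: "continuous_on (closure \<Omega>) J"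
    by (rule continuous_on_componentwise_inner) (use k in auto)
  then have "J ` closure \<Omega> \<subseteq> closure D"
    using maps closure_subset by (intro image_closure_subset) auto
  then show ?case using k J by (auto intro: continuous_on_compose2)
next
  case (Suc k)
  have J: "continuous_on (closure \<Omega>) J"
    by (rule continuous_on_componentwise_inner) (use Suc.prems in auto)
  then have "J ` closure \<Omega> \<subseteq> closure D"
    using maps closure_subset by (intro image_closure_subset) auto
  then have cont: "continuous_on (closure \<Omega>) (\<lambda>x. f (J x))"
    using Suc.prems(1) J by (auto intro: continuous_on_compose2)
  have dJ: "J differentiable at x" if "x \<in> \<Omega>" for x
    using Suc.prems(2) that by (subst differentiable_componentwise_within) auto
  have df: "f differentiable at (J x)" if "x \<in> \<Omega>" for x
    using Suc.prems(1) maps that by auto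
  show ?case
  proof (rule Ck_closure_SucI
      [where g = "\<lambda>b x. \<Sum>c\<in>Basis. dderiv \<Omega> b (\<lambda>x. J x \<bullet> c) x * dderiv D c f (J x)"])
    fix b :: 'a assume b: "b \<in> Basis"
    show "Ck_closure k \<Omega> (\<lambda>x. \<Sum>c\<in>Basis. dderiv \<Omega> b (\<lambda>x. J x \<bullet> c) x * dderiv D c f (J x))"
    proof (rule Ck_closure_sum[OF \<open>open \<Omega>\<close>], rule Ck_closure_mult[OF \<open>open \<Omega>\<close>])
      fix c :: 'b assume c: "c \<in> Basis"
      show "Ck_closure k \<Omega> (dderiv \<Omega> b (\<lambda>x. J x \<bullet> c))"
        using Suc.prems(2)[OF c] b by simp
      show "Ck_closure k \<Omega> (\<lambda>x. dderiv D c f (J x))"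
        by (rule Suc.IH) (use Suc.prems c in \<open>auto intro: Ck_closure_SucD\<close>)
    qed
    fix x assume x: "x \<in> \<Omega>"
    define J' f' where "J' = frechet_derivative J (at x)" and "f' = frechet_derivative f (at (J x))"
    have J': "(J has_derivative J') (at x)" and f': "(f has_derivative f') (at (J x))"
      using dJ df x by (simp_all add: frechet_derivative_works J'_def f'_def)
    have comp: "dderiv \<Omega> b (\<lambda>x. J x \<bullet> c) x = J' b \<bullet> c" for c
      using x by (intro dderiv_eqI) (auto intro!: derivative_eq_intros J')
    have "linear f'" using f' has_derivative_linear by blast
    have "dderiv \<Omega> b (\<lambda>x. f (J x)) x = f' (J' b)"
      using x diff_chain_at[OF J' f'] by (intro dderiv_eqI) (auto simp: o_def)
    also have "\<dots> = f' (\<Sum>c\<in>Basis. (J' b \<bullet> c) *\<^sub>R c)"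
      by (simp add: euclidean_representation)
    also have "\<dots> = (\<Sum>c\<in>Basis. (J' b \<bullet> c) * f' c)"
      using \<open>linear f'\<close> by (simp add: linear_sum linear_scale)
    also have "\<dots> = (\<Sum>c\<in>Basis. dderiv \<Omega> b (\<lambda>x. J x \<bullet> c) x * dderiv D c f (J x))"
      using x maps by (intro sum.cong) (auto simp: comp dderiv_inside f'_def)
    finally show "dderiv \<Omega> b (\<lambda>x. f (J x)) x =
      (\<Sum>c\<in>Basis. dderiv \<Omega> b (\<lambda>x. J x \<bullet> c) x * dderiv D c f (J x))" .
  next
    fix x assume x: "x \<in> \<Omega>"
    show "(\<lambda>x. f (J x)) differentiable at x"
      using differentiable_chain_at[OF dJ[OF x] df[OF x]] by (simp add: o_def)
  qed (use assms cont in auto)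
qed

lemma Ck_on_continuous: "Ck_on k U f \<Longrightarrow> continuous_on U f"
  by (cases k) (auto simp: continuous_at_imp_continuous_on differentiable_imp_continuous_within)

text \<open>If \<open>f\<close> is \<open>C\<^sup>k\<close> near the closure, its ordinary partial derivatives are the boundary values.\<close>

lemma Ck_on_imp_Ck_closure:
  assumes "open \<Omega>" "closure \<Omega> \<subseteq> U"
  shows "Ck_on k U f \<Longrightarrow> Ck_closure k \<Omega> f"
proof (induction k arbitrary: f)
  case 0
  then show ?case using assms continuous_on_subset by auto
next
  case (Suc k)
  have "\<Omega> \<subseteq> U" using assms closure_subset by blast
  then show ?case
    using Suc assms Ck_on_continuous[OF Suc.prems]
    by (intro Ck_closure_SucI[where g = "\<lambda>b x. frechet_derivative f (at x) b"])
       (auto simp: dderiv_inside intro: continuous_on_subset)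
qed

section \<open>Symmetry of second derivatives\<close>

text \<open>
  The second difference of \<open>f\<close> over a small parallelogram with sides \<open>s a\<close> and \<open>s b\<close> is \<open>s\<^sup>2\<close> times
  a mixed second derivative at some point of the parallelogram, by the mean value theorem in
  direction \<open>a\<close> and then in direction \<open>b\<close>. The second difference is symmetric in \<open>a\<close> and \<open>b\<close>,
  which gives the symmetry of second derivatives in the limit \<open>s \<rightarrow> 0\<close>.
\<close>

lemma second_difference_mean_value:
  fixes f :: "'a::real_normed_vector \<Rightarrow> real"
  assumes "0 < s"
    and f: "\<And>\<xi> \<eta>. 0 \<le> \<xi> \<Longrightarrow> \<xi> \<le> s \<Longrightarrow> 0 \<le> \<eta> \<Longrightarrow> \<eta> \<le> s \<Longrightarrow>
          f differentiable at (x + \<xi> *\<^sub>R a + \<eta> *\<^sub>R b)"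
    and g: "\<And>\<xi> \<eta>. 0 \<le> \<xi> \<Longrightarrow> \<xi> \<le> s \<Longrightarrow> 0 \<le> \<eta> \<Longrightarrow> \<eta> \<le> s \<Longrightarrow>
          (\<lambda>y. frechet_derivative f (at y) a) differentiable at (x + \<xi> *\<^sub>R a + \<eta> *\<^sub>R b)"
  obtains \<xi> \<eta> where "0 < \<xi>" "\<xi> < s" "0 < \<eta>" "\<eta> < s"
    "f (x + s *\<^sub>R a + s *\<^sub>R b) - f (x + s *\<^sub>R a) - f (x + s *\<^sub>R b) + f x =
     s * s * frechet_derivative (\<lambda>y. frechet_derivative f (at y) a) (at (x + \<xi> *\<^sub>R a + \<eta> *\<^sub>R b)) b"
proof -
  let ?g = "\<lambda>y. frechet_derivative f (at y) a"
  define \<phi> where "\<phi> \<tau> = f (x + \<tau> *\<^sub>R a + s *\<^sub>R b) - f (x + \<tau> *\<^sub>R a + 0 *\<^sub>R b)" for \<tau>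
  have line: "((\<lambda>\<tau>. h (x + \<tau> *\<^sub>R a + \<eta> *\<^sub>R b)) has_real_derivative
      frechet_derivative h (at (x + \<xi> *\<^sub>R a + \<eta> *\<^sub>R b)) a) (at \<xi>)"
    if "h differentiable at (x + \<xi> *\<^sub>R a + \<eta> *\<^sub>R b)" for h :: "'a \<Rightarrow> real" and \<xi> \<eta> a b x
  proof -
    have 1: "((\<lambda>\<tau>. x + \<tau> *\<^sub>R a + \<eta> *\<^sub>R b) has_derivative (\<lambda>t. t *\<^sub>R a)) (at \<xi>)"
      by (auto intro!: derivative_eq_intros)
    have "((\<lambda>\<tau>. h (x + \<tau> *\<^sub>R a + \<eta> *\<^sub>R b)) has_derivative
        (\<lambda>t. frechet_derivative h (at (x + \<xi> *\<^sub>R a + \<eta> *\<^sub>R b)) (t *\<^sub>R a))) (at \<xi>)"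
      using diff_chain_at[OF 1] that by (simp add: frechet_derivative_works o_def)
    moreover have "frechet_derivative h (at (x + \<xi> *\<^sub>R a + \<eta> *\<^sub>R b)) (t *\<^sub>R a)
        = frechet_derivative h (at (x + \<xi> *\<^sub>R a + \<eta> *\<^sub>R b)) a * t" for t
      using linear_frechet_derivative[OF that] by (simp add: linear_scale)
    ultimately show ?thesis by (simp add: has_field_derivative_def)
  qed
  have "\<exists>\<xi>. 0 < \<xi> \<and> \<xi> < s \<and> \<phi> s - \<phi> 0 =
      (s - 0) * (?g (x + \<xi> *\<^sub>R a + s *\<^sub>R b) - ?g (x + \<xi> *\<^sub>R a + 0 *\<^sub>R b))"
    unfolding \<phi>_def using \<open>0 < s\<close>
    by (intro MVT2 DERIV_diff line f) auto
  then obtain \<xi> where \<xi>: "0 < \<xi>" "\<xi> < s"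
    "\<phi> s - \<phi> 0 = s * (?g (x + \<xi> *\<^sub>R a + s *\<^sub>R b) - ?g (x + \<xi> *\<^sub>R a + 0 *\<^sub>R b))" by auto
  have "\<exists>\<eta>. 0 < \<eta> \<and> \<eta> < s \<and> ?g (x + s *\<^sub>R b + \<xi> *\<^sub>R a) - ?g (x + 0 *\<^sub>R b + \<xi> *\<^sub>R a) =
      (s - 0) * frechet_derivative ?g (at (x + \<eta> *\<^sub>R b + \<xi> *\<^sub>R a)) b"
    using \<open>0 < s\<close> \<xi> g[of \<xi>]
    by (intro MVT2 line) (auto simp: add_ac)
  then show ?thesis
    using that \<xi> by (auto simp: \<phi>_def add_ac algebra_simps)
qed

lemma second_derivative_symmetric:
  fixes f :: "'a::real_normed_vector \<Rightarrow> real"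
  assumes "open S" "x \<in> S"
    and f: "\<And>y. y \<in> S \<Longrightarrow> f differentiable at y"
    and fa: "\<And>y. y \<in> S \<Longrightarrow> (\<lambda>y. frechet_derivative f (at y) a) differentiable at y"
    and fb: "\<And>y. y \<in> S \<Longrightarrow> (\<lambda>y. frechet_derivative f (at y) b) differentiable at y"
    and cab: "continuous_on S (\<lambda>z. frechet_derivative (\<lambda>y. frechet_derivative f (at y) a) (at z) b)"
    and cba: "continuous_on S (\<lambda>z. frechet_derivative (\<lambda>y. frechet_derivative f (at y) b) (at z) a)"
  shows "frechet_derivative (\<lambda>y. frechet_derivative f (at y) a) (at x) b =
         frechet_derivative (\<lambda>y. frechet_derivative f (at y) b) (at x) a"
proof -
  define ab where "ab = (\<lambda>z. frechet_derivative (\<lambda>y. frechet_derivative f (at y) a) (at z) b)"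
  define ba where "ba = (\<lambda>z. frechet_derivative (\<lambda>y. frechet_derivative f (at y) b) (at z) a)"
  have near: "\<bar>ab x - ba x\<bar> < e" if "0 < e" for e
  proof -
    have "isCont ab x" "isCont ba x"
      using cab cba assms(1,2) by (auto simp: ab_def ba_def continuous_on_eq_continuous_at)
    then have "(ab \<longlongrightarrow> ab x) (nhds x)" "(ba \<longlongrightarrow> ba x) (nhds x)"
      by (simp_all only: isCont_def tendsto_at_iff_tendsto_nhds[of ab]
          tendsto_at_iff_tendsto_nhds[of ba])
    then have "\<forall>\<^sub>F z in nhds x. dist (ab z) (ab x) < e/2" "\<forall>\<^sub>F z in nhds x. dist (ba z) (ba x) < e/2"
      using \<open>0 < e\<close> by (auto intro!: tendstoD[where e = "e/2"] simp del: less_divide_eq_numeral1)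
    then have "\<forall>\<^sub>F z in nhds x. z \<in> S \<and> dist (ab z) (ab x) < e/2 \<and> dist (ba z) (ba x) < e/2"
      using assms(1,2) by (intro eventually_conj) (auto intro: eventually_nhds_in_open)
    then obtain d where "0 < d" and d: "\<And>z. dist z x < d \<Longrightarrow>
        z \<in> S \<and> dist (ab z) (ab x) < e/2 \<and> dist (ba z) (ba x) < e/2"
      unfolding eventually_nhds_metric by blast
    define s where "s = d / (2 * (norm a + norm b + 1))"
    have pos: "0 < norm a + norm b + 1"
      using norm_ge_zero[of a] norm_ge_zero[of b] by linarith
    then have "0 < s" using \<open>0 < d\<close> by (simp add: s_def)
    have close: "dist (x + \<xi> *\<^sub>R a + \<eta> *\<^sub>R b) x < d" if "0 \<le> \<xi>" "\<xi> \<le> s" "0 \<le> \<eta>" "\<eta> \<le> s" for \<xi> \<eta>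
    proof -
      have "dist (x + \<xi> *\<^sub>R a + \<eta> *\<^sub>R b) x \<le> norm (\<xi> *\<^sub>R a) + norm (\<eta> *\<^sub>R b)"
        by (simp add: dist_norm add.assoc norm_triangle_ineq del: norm_scaleR)
      also have "\<dots> \<le> s * norm a + s * norm b"
        using that by (auto intro!: add_mono mult_right_mono)
      also have "\<dots> < 2 * s * (norm a + norm b + 1)"
        using \<open>0 < s\<close> by (simp add: algebra_simps add_nonneg_pos)
      also have "\<dots> = d" using pos by (simp add: s_def field_simps)
      finally show ?thesis .
    qed
    have close': "dist (x + \<xi> *\<^sub>R b + \<eta> *\<^sub>R a) x < d" if "0 \<le> \<xi>" "\<xi> \<le> s" "0 \<le> \<eta>" "\<eta> \<le> s" for \<xi> \<eta>
      using close[of \<eta> \<xi>] that by (simp add: add_ac)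
    obtain \<xi> \<eta> where 1: "0 < \<xi>" "\<xi> < s" "0 < \<eta>" "\<eta> < s"
      "f (x + s *\<^sub>R a + s *\<^sub>R b) - f (x + s *\<^sub>R a) - f (x + s *\<^sub>R b) + f x =
       s * s * ab (x + \<xi> *\<^sub>R a + \<eta> *\<^sub>R b)"
    proof (rule second_difference_mean_value[OF \<open>0 < s\<close>, of f x a b])
      fix \<xi> \<eta> assume "0 \<le> \<xi>" "\<xi> \<le> s" "0 \<le> \<eta>" "\<eta> \<le> s"
      then have "x + \<xi> *\<^sub>R a + \<eta> *\<^sub>R b \<in> S" using d close by blast
      then show "f differentiable at (x + \<xi> *\<^sub>R a + \<eta> *\<^sub>R b)"
        "(\<lambda>y. frechet_derivative f (at y) a) differentiable at (x + \<xi> *\<^sub>R a + \<eta> *\<^sub>R b)"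
        by (simp_all add: f fa)
    qed (unfold ab_def, blast)
    obtain \<xi>' \<eta>' where 2: "0 < \<xi>'" "\<xi>' < s" "0 < \<eta>'" "\<eta>' < s"
      "f (x + s *\<^sub>R b + s *\<^sub>R a) - f (x + s *\<^sub>R b) - f (x + s *\<^sub>R a) + f x =
       s * s * ba (x + \<xi>' *\<^sub>R b + \<eta>' *\<^sub>R a)"
    proof (rule second_difference_mean_value[OF \<open>0 < s\<close>, of f x b a])
      fix \<xi> \<eta> assume "0 \<le> \<xi>" "\<xi> \<le> s" "0 \<le> \<eta>" "\<eta> \<le> s"
      then have "x + \<xi> *\<^sub>R b + \<eta> *\<^sub>R a \<in> S" using d close' by blast
      then show "f differentiable at (x + \<xi> *\<^sub>R b + \<eta> *\<^sub>R a)"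
        "(\<lambda>y. frechet_derivative f (at y) b) differentiable at (x + \<xi> *\<^sub>R b + \<eta> *\<^sub>R a)"
        by (simp_all add: f fb)
    qed (unfold ba_def, blast)
    have "s * s * ab (x + \<xi> *\<^sub>R a + \<eta> *\<^sub>R b) = s * s * ba (x + \<xi>' *\<^sub>R b + \<eta>' *\<^sub>R a)"
      using 1(5) 2(5) by (simp add: add_ac algebra_simps)
    then have "ab (x + \<xi> *\<^sub>R a + \<eta> *\<^sub>R b) = ba (x + \<xi>' *\<^sub>R b + \<eta>' *\<^sub>R a)"
      using \<open>0 < s\<close> by simp
    moreover have "dist (ab (x + \<xi> *\<^sub>R a + \<eta> *\<^sub>R b)) (ab x) < e/2"
      "dist (ba (x + \<xi>' *\<^sub>R b + \<eta>' *\<^sub>R a)) (ba x) < e/2"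
      using d close close' 1 2 by simp_all
    ultimately show ?thesis unfolding dist_real_def by linarith
  qed
  show ?thesis using near[of "\<bar>ab x - ba x\<bar>"] by (fastforce simp: ab_def ba_def)
qed

section \<open>Vector fields as differential operators\<close>

lemma vec_expansion: "(x::real^'n) = (\<Sum>k\<in>UNIV. x $ k *\<^sub>R axis k 1)"
  by (simp add: basis_expansion scalar_mult_eq_scaleR[symmetric])

lemma vf_app_eqI:
  assumes f: "(f has_derivative f') (at x)" and x: "x \<in> \<Omega>"
  shows "vf_app \<Omega> Y f x = f' (Y x)"
proof -
  have "f' (Y x) = f' (\<Sum>k\<in>UNIV. Y x $ k *\<^sub>R axis k 1)"
    by (rule arg_cong[where f = f', OF vec_expansion])
  also have "\<dots> = vf_app \<Omega> Y f x"
    using has_derivative_linear[OF f] x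
    by (simp add: linear_sum linear_scale vf_app_def dderiv_eqI[OF f])
  finally show ?thesis by simp
qed

lemma vf_app_inside:
  "f differentiable at x \<Longrightarrow> x \<in> \<Omega> \<Longrightarrow> vf_app \<Omega> Y f x = frechet_derivative f (at x) (Y x)"
  by (simp add: vf_app_eqI frechet_derivative_works)

lemma vf_app_mult:
  assumes "f differentiable at x" "g differentiable at x" "x \<in> \<Omega>"
  shows "vf_app \<Omega> Y (\<lambda>y. f y * g y) x = f x * vf_app \<Omega> Y g x + vf_app \<Omega> Y f x * g x"
proof -
  have "((\<lambda>y. f y * g y) has_derivative
      (\<lambda>h. f x * frechet_derivative g (at x) h + frechet_derivative f (at x) h * g x)) (at x)"
    using assms by (intro has_derivative_mult) (auto simp: frechet_derivative_works)
  then show ?thesis using assms by (simp add: vf_app_eqI vf_app_inside)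
qed

lemma vf_app_diff:
  assumes "f differentiable at x" "g differentiable at x" "x \<in> \<Omega>"
  shows "vf_app \<Omega> Y (\<lambda>y. f y - g y) x = vf_app \<Omega> Y f x - vf_app \<Omega> Y g x"
proof -
  have "((\<lambda>y. f y - g y) has_derivative
      (\<lambda>h. frechet_derivative f (at x) h - frechet_derivative g (at x) h)) (at x)"
    using assms by (intro has_derivative_diff) (auto simp: frechet_derivative_works)
  then show ?thesis using assms by (simp add: vf_app_eqI vf_app_inside)
qed

lemma vf_app_coordinate: "x \<in> \<Omega> \<Longrightarrow> vf_app \<Omega> Y (\<lambda>y. c * y $ k) x = c * Y x $ k"
  by (rule vf_app_eqI)
     (auto intro!: bounded_linear_imp_has_derivative bounded_linear_const_mult bounded_linear_vec_nth)

lemma axis_Basis [simp]: "axis k (1::real) \<in> Basis"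
  by (auto simp: Basis_vec_def)

lemma Ck_closure_vf_app:
  assumes "open \<Omega>" "Ck_closure (Suc k) \<Omega> f" "\<And>l. Ck_closure k \<Omega> (\<lambda>x. Y x $ l)"
  shows "Ck_closure k \<Omega> (vf_app \<Omega> Y f)"
  unfolding vf_app_def[abs_def] using assms by (intro Ck_closure_sum Ck_closure_mult) auto

lemma smooth_vf_Ck_closure:
  "open \<Omega> \<Longrightarrow> smooth_vf Y \<Longrightarrow> Ck_closure k \<Omega> (\<lambda>x. Y x $ l)"
  unfolding smooth_vf_def smooth_def using Ck_on_imp_Ck_closure[of \<Omega> UNIV] by auto

lemma smooth_vf_differentiable: "smooth_vf Y \<Longrightarrow> (\<lambda>x. Y x $ l) differentiable at x"
  unfolding smooth_vf_def smooth_def by (metis Ck_on.simps(2) UNIV_I)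

lemma smooth_linear:
  assumes f: "bounded_linear f"
  shows "smooth f"
proof -
  have const: "Ck_on k UNIV (\<lambda>x. c)" for k c by (induction k arbitrary: c) auto
  have "(f has_derivative f) (at x)" for x
    by (rule bounded_linear_imp_has_derivative[OF f])
  then have "f differentiable at x" "frechet_derivative f (at x) = f" for x
    using differentiable_def frechet_derivative_at by metis+
  then have "Ck_on k UNIV f" for k
    using const f by (cases k) (auto simp: linear_continuous_on)
  then show ?thesis by (simp add: smooth_def)
qed

lemma dderiv_commute:
  assumes "open \<Omega>" "x \<in> \<Omega>" and u: "Ck_closure 2 \<Omega> u" and ab: "a \<in> Basis" "b \<in> Basis"
  shows "dderiv \<Omega> b (dderiv \<Omega> a u) x = dderiv \<Omega> a (dderiv \<Omega> b u) x"
proof -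
  let ?D = "\<lambda>c y. frechet_derivative u (at y) c"
  have u': "Ck_closure (Suc (Suc 0)) \<Omega> u" using u by (simp add: numeral_2_eq_2)
  have diff: "(?D c) differentiable at y" if "c \<in> Basis" "y \<in> \<Omega>" for c y
  proof -
    have "dderiv \<Omega> c u differentiable at y" using u' that by simp
    then obtain D where D: "(dderiv \<Omega> c u has_derivative D) (at y)"
      unfolding differentiable_def by blast
    have "(?D c has_derivative D) (at y)"
      by (rule has_derivative_transform_within_open[OF D \<open>open \<Omega>\<close> \<open>y \<in> \<Omega>\<close>]) (simp add: dderiv_inside)
    then show ?thesis by (rule differentiableI)
  qed
  have eq: "dderiv \<Omega> d (dderiv \<Omega> c u) y = frechet_derivative (?D c) (at y) d" if "y \<in> \<Omega>" for c d y
    using dderiv_cong[OF \<open>open \<Omega>\<close>, of "dderiv \<Omega> c u" "?D c" d] that by (simp add: dderiv_inside)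
  have cont: "continuous_on \<Omega> (\<lambda>y. frechet_derivative (?D c) (at y) d)" if "c \<in> Basis" "d \<in> Basis" for c d
  proof -
    have "continuous_on (closure \<Omega>) (dderiv \<Omega> d (dderiv \<Omega> c u))"
      using u' that by simp
    then have "continuous_on \<Omega> (dderiv \<Omega> d (dderiv \<Omega> c u))"
      using closure_subset by (rule continuous_on_subset)
    then show ?thesis
      using eq by (simp cong: continuous_on_cong)
  qed
  show ?thesis
    unfolding eq[OF \<open>x \<in> \<Omega>\<close>]
  proof (rule second_derivative_symmetric[OF \<open>open \<Omega>\<close> \<open>x \<in> \<Omega>\<close>])
    show "u differentiable at y" if "y \<in> \<Omega>" for y
      using u' that by simp
  qed (rule diff cont ab | assumption)+
qed

text \<open>
  The commutator of two fields, applied to a \<open>C\<^sup>2\<close> function, is the action of their bracket: the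
  second derivatives of \<open>u\<close> cancel by symmetry.
\<close>

lemma vf_app_bracket:
  assumes "open \<Omega>" "x \<in> \<Omega>" and u: "Ck_closure 2 \<Omega> u"
    and Y: "\<And>l. (\<lambda>y. Y y $ l) differentiable at x" and Z: "\<And>l. (\<lambda>y. Z y $ l) differentiable at x"
  shows "vf_app \<Omega> Y (vf_app \<Omega> Z u) x - vf_app \<Omega> Z (vf_app \<Omega> Y u) x = vf_app \<Omega> (vf_bracket Y Z) u x"
proof -
  let ?d = "\<lambda>k. dderiv \<Omega> (axis k 1) u"
  have du: "?d l differentiable at x" for l
    using u assms(2) by (simp add: numeral_2_eq_2)
  have iterate: "vf_app \<Omega> V (vf_app \<Omega> W u) x =
      (\<Sum>l\<in>UNIV. vf_app UNIV V (\<lambda>y. W y $ l) x * ?d l x) +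
      (\<Sum>l\<in>UNIV. \<Sum>k\<in>UNIV. W x $ l * V x $ k * dderiv \<Omega> (axis k 1) (?d l) x)"
    if W: "\<And>l. (\<lambda>y. W y $ l) differentiable at x" for V W
  proof -
    have "((\<lambda>y. \<Sum>l\<in>UNIV. W y $ l * ?d l y) has_derivative
        (\<lambda>h. \<Sum>l\<in>UNIV. W x $ l * frechet_derivative (?d l) (at x) h
                    + frechet_derivative (\<lambda>y. W y $ l) (at x) h * ?d l x)) (at x)"
      using W du by (intro has_derivative_sum has_derivative_mult) (auto simp: frechet_derivative_works)
    then have "vf_app \<Omega> V (vf_app \<Omega> W u) x =
        (\<Sum>l\<in>UNIV. W x $ l * vf_app \<Omega> V (?d l) x + vf_app UNIV V (\<lambda>y. W y $ l) x * ?d l x)"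
      using assms(2) W du by (simp add: vf_app_eqI vf_app_inside vf_app_def[of \<Omega> W, abs_def])
    also have "\<dots> = (\<Sum>l\<in>UNIV. vf_app UNIV V (\<lambda>y. W y $ l) x * ?d l x) +
        (\<Sum>l\<in>UNIV. W x $ l * vf_app \<Omega> V (?d l) x)"
      by (simp add: sum.distrib)
    finally show ?thesis
      by (simp add: vf_app_def[of \<Omega> V] sum_distrib_left mult.assoc)
  qed
  have "(\<Sum>l\<in>UNIV. \<Sum>k\<in>UNIV. Z x $ l * Y x $ k * dderiv \<Omega> (axis k 1) (?d l) x) =
        (\<Sum>l\<in>UNIV. \<Sum>k\<in>UNIV. Y x $ l * Z x $ k * dderiv \<Omega> (axis k 1) (?d l) x)"
    by (subst sum.swap) (simp add: dderiv_commute[OF assms(1-3), of "axis _ 1" "axis _ 1"] mult.commute)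
  then show ?thesis
    by (simp add: iterate Y Z vf_app_def[of \<Omega> "vf_bracket Y Z"] vf_bracket_def left_diff_distrib
        sum_subtractf)
qed

section \<open>Homogeneous vector fields of degree one\<close>

text \<open>
  Applied to the coordinate function \<open>x\<^sub>k\<close>, homogeneity of degree one says that the \<open>k\<close>-th
  coefficient of \<open>X\<^sub>i\<close> is homogeneous of degree \<open>\<sigma>\<^sub>k - 1\<close>.
\<close>

lemma homogeneous_vfs_component:
  assumes "homogeneous_vfs \<sigma> X" "0 < t"
  shows "t * X i (dilation \<sigma> t x) $ k = t ^ \<sigma> k * X i x $ k"
proof -
  have "smooth (\<lambda>y::real^'a. y $ k)"
    by (intro smooth_linear bounded_linear_vec_nth)
  then have "vf_app UNIV (X i) ((\<lambda>y. y $ k) \<circ> dilation \<sigma> t) x =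
      t * (vf_app UNIV (X i) (\<lambda>y. y $ k) \<circ> dilation \<sigma> t) x"
    using assms unfolding homogeneous_vfs_def by metis
  then show ?thesis
    using vf_app_coordinate[of _ UNIV "X i" 1 k]
      vf_app_coordinate[of x UNIV "X i" "t ^ \<sigma> k" k]
    by (simp add: o_def dilation_def)
qed

text \<open>
  The \<open>k\<close>-th coefficient of \<open>X\<^sub>i\<close> does not depend on \<open>x\<^sub>k\<close>: its derivative \<open>g\<close> with respect to \<open>x\<^sub>k\<close>
  is homogeneous of degree \<open>-1\<close>, that is \<open>t g(\<delta>\<^sub>t x) = g x\<close>, and \<open>t \<rightarrow> 0\<close> gives \<open>g x = 0\<close>
  because \<open>g\<close> is continuous. In particular \<open>X\<^sub>i\<close> is divergence-free.
\<close>

lemma homogeneous_vfs_divergence_free: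
  assumes "homogeneous_vfs \<sigma> X" and smooth: "smooth_vf (X i)"
  shows "frechet_derivative (\<lambda>y. X i y $ k) (at x) (axis k 1) = 0"
proof -
  define a where "a = (\<lambda>y. X i y $ k)"
  define g where "g y = frechet_derivative a (at y) (axis k 1)" for y
  have a: "(a has_derivative frechet_derivative a (at y)) (at y)" for y
    using smooth_vf_differentiable[OF smooth] by (simp add: a_def frechet_derivative_works)
  have "Ck_on (Suc 0) UNIV a"
    using smooth unfolding smooth_vf_def smooth_def a_def by blast
  then have g: "continuous_on UNIV g" by (simp add: g_def[abs_def])
  have scale: "t * g (dilation \<sigma> t x) = g x" if "0 < t" for t
  proof -
    have lin: "bounded_linear (dilation \<sigma> t)"
      unfolding dilation_def
      by (intro linear_conv_bounded_linear[THEN iffD1] linearI) (auto simp: vec_eq_iff algebra_simps)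
    have "((\<lambda>y. t * a (dilation \<sigma> t y)) has_derivative
        (\<lambda>h. t * frechet_derivative a (at (dilation \<sigma> t x)) (dilation \<sigma> t h))) (at x)"
      using diff_chain_at[OF bounded_linear_imp_has_derivative[OF lin] a]
      by (intro has_derivative_mult_right) (simp add: o_def)
    moreover have "((\<lambda>y. t * a (dilation \<sigma> t y)) has_derivative
        (\<lambda>h. t ^ \<sigma> k * frechet_derivative a (at x) h)) (at x)"
      using homogeneous_vfs_component[OF assms(1) that, of i _ k]
        has_derivative_mult_right[OF a[of x], of "t ^ \<sigma> k"]
      by (simp add: a_def)
    ultimately have "t * frechet_derivative a (at (dilation \<sigma> t x)) (dilation \<sigma> t (axis k 1)) = t ^ \<sigma> k * g x"
      unfolding g_def using has_derivative_unique by metis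
    moreover have "dilation \<sigma> t (axis k 1) = t ^ \<sigma> k *\<^sub>R axis k 1"
      by (simp add: dilation_def vec_eq_iff axis_def)
    moreover have "linear (frechet_derivative a (at (dilation \<sigma> t x)))"
      using a has_derivative_linear by blast
    ultimately show ?thesis
      using that by (simp add: linear_scale g_def)
  qed
  have "((\<lambda>t. dilation \<sigma> t x) \<longlongrightarrow> dilation \<sigma> 0 x) (at_right 0)"
    unfolding dilation_def by (intro tendsto_intros)
  then have "((\<lambda>t. g (dilation \<sigma> t x)) \<longlongrightarrow> g (dilation \<sigma> 0 x)) (at_right 0)"
    using g continuous_on_eq_continuous_at[OF open_UNIV] isCont_tendsto_compose by blast
  then have "((\<lambda>t. t * g (dilation \<sigma> t x)) \<longlongrightarrow> 0 * g (dilation \<sigma> 0 x)) (at_right 0)"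
    by (intro tendsto_mult tendsto_ident_at)
  moreover have "\<forall>\<^sub>F t in at_right 0. t * g (dilation \<sigma> t x) = g x"
    using scale by (auto simp: eventually_at_filter)
  ultimately have "((\<lambda>t. g x) \<longlongrightarrow> 0) (at_right (0::real))"
    using Lim_transform_eventually by fastforce
  then show ?thesis
    by (simp add: tendsto_const_iff g_def a_def)
qed

lemma euler_vf_coordinate: "(\<lambda>y. euler_vf \<sigma> y $ k) = (\<lambda>y. real (\<sigma> k) * y $ k)"
  by (simp add: euler_vf_def)

text \<open>
  Euler's identity for the coefficients, that is, the derivative of their homogeneity relation with
  respect to \<open>t\<close> at \<open>t = 1\<close>, in the form \<open>[X\<^sub>i, T] = X\<^sub>i\<close>.
\<close>

lemma homogeneous_vfs_bracket_euler:
  assumes "homogeneous_vfs \<sigma> X" and smooth: "smooth_vf (X i)"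
  shows "vf_bracket (X i) (euler_vf \<sigma>) = X i"
proof (intro ext, subst vec_eq_iff, intro allI)
  fix x k
  define a where "a = (\<lambda>y. X i y $ k)"
  define a' where "a' = frechet_derivative a (at x)"
  have a: "(a has_derivative a') (at x)" "a differentiable at x"
    using smooth_vf_differentiable[OF smooth] by (simp_all add: a_def a'_def frechet_derivative_works)
  have d1: "dilation \<sigma> 1 x = x" by (simp add: dilation_def vec_eq_iff)
  have "((\<lambda>t. \<Sum>l\<in>UNIV. (t ^ \<sigma> l * x $ l) *\<^sub>R axis l (1::real)) has_derivative
      (\<lambda>h. \<Sum>l\<in>UNIV. (h * real (\<sigma> l) * x $ l) *\<^sub>R axis l 1)) (at (1::real))"
    by (auto intro!: derivative_eq_intros sum.cong)
  moreover have "dilation \<sigma> t x = (\<Sum>l\<in>UNIV. (t ^ \<sigma> l * x $ l) *\<^sub>R axis l 1)" for t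
    using vec_expansion[of "dilation \<sigma> t x"] by (simp add: dilation_def)
  moreover have "h *\<^sub>R euler_vf \<sigma> x = (\<Sum>l\<in>UNIV. (h * real (\<sigma> l) * x $ l) *\<^sub>R axis l 1)" for h
    using vec_expansion[of "h *\<^sub>R euler_vf \<sigma> x"] by (simp add: euler_vf_def mult.assoc)
  ultimately have "((\<lambda>t. dilation \<sigma> t x) has_derivative (\<lambda>h. h *\<^sub>R euler_vf \<sigma> x)) (at 1)"
    by simp
  then have "((\<lambda>t. t * a (dilation \<sigma> t x)) has_derivative
      (\<lambda>h. 1 * a' (h *\<^sub>R euler_vf \<sigma> x) + h * a x)) (at 1)"
    using diff_chain_at[of "\<lambda>t. dilation \<sigma> t x" _ 1 a a'] a(1) has_derivative_ident
    by (intro has_derivative_eq_rhs[OF has_derivative_mult]) (auto simp: d1 o_def)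
  moreover have "((\<lambda>t. t * a (dilation \<sigma> t x)) has_derivative (\<lambda>h. h * real (\<sigma> k) * a x)) (at 1)"
  proof (rule has_derivative_transform_within_open)
    show "((\<lambda>t. t ^ \<sigma> k * a x) has_derivative (\<lambda>h. h * real (\<sigma> k) * a x)) (at (1::real))"
      by (auto intro!: derivative_eq_intros)
    show "t ^ \<sigma> k * a x = t * a (dilation \<sigma> t x)" if "t \<in> {0<..}" for t
      using homogeneous_vfs_component[OF assms(1), of t i x k] that by (simp add: a_def)
  qed auto
  ultimately have "(\<lambda>h. 1 * a' (h *\<^sub>R euler_vf \<sigma> x) + h * a x) = (\<lambda>h. h * real (\<sigma> k) * a x)"
    by (rule has_derivative_unique)
  from fun_cong[OF this, of 1] have "a' (euler_vf \<sigma> x) + a x = real (\<sigma> k) * a x"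
    by simp
  then show "vf_bracket (X i) (euler_vf \<sigma>) x $ k = X i x $ k"
    using a by (simp add: vf_bracket_def euler_vf_coordinate vf_app_coordinate a_def[symmetric]
        vf_app_inside a'_def) (simp add: a_def)
qed

lemma euler_vf_divergence:
  assumes "x \<in> \<Omega>"
  shows "(\<Sum>k\<in>UNIV. dderiv \<Omega> (axis k 1) (\<lambda>y. euler_vf \<sigma> y $ k) x) = real (\<Sum>k\<in>UNIV. \<sigma> k)"
proof -
  have "dderiv \<Omega> b (\<lambda>y. real (\<sigma> k) * y $ k) x = real (\<sigma> k) * b $ k" for b k
    using assms by (intro dderiv_eqI bounded_linear_imp_has_derivative bounded_linear_const_mult
        bounded_linear_vec_nth)
  then show ?thesis by (simp add: euler_vf_coordinate)
qed

lemma vf_app_commute_euler: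
  assumes "homogeneous_vfs \<sigma> X" "smooth_vf (X i)" "open \<Omega>" "x \<in> \<Omega>" "Ck_closure 2 \<Omega> v"
  shows "vf_app \<Omega> (euler_vf \<sigma>) (vf_app \<Omega> (X i) v) x =
    vf_app \<Omega> (X i) (vf_app \<Omega> (euler_vf \<sigma>) v) x - vf_app \<Omega> (X i) v x"
proof -
  have "(\<lambda>y. euler_vf \<sigma> y $ l) differentiable at x" for l
    unfolding euler_vf_coordinate
    by (intro bounded_linear_imp_differentiable bounded_linear_const_mult bounded_linear_vec_nth)
  then show ?thesis
    using vf_app_bracket[of \<Omega> x v "X i" "euler_vf \<sigma>"] assms
    by (simp add: homogeneous_vfs_bracket_euler smooth_vf_differentiable)
qed

section \<open>The chain rule along the jet of a function\<close>

lemma vf_app_jet: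
  fixes X :: "'m::finite \<Rightarrow> real^'n \<Rightarrow> real^'n" and F :: "('n, 'm) jet \<Rightarrow> real"
  assumes x: "x \<in> \<Omega>" and F: "F differentiable at (jet_of \<Omega> X u x)"
    and u: "u differentiable at x"
    and Xu: "\<And>i. vf_app \<Omega> (X i) u differentiable at x"
    and XXu: "\<And>i j. vf_app \<Omega> (X j) (vf_app \<Omega> (X i) u) differentiable at x"
  shows "vf_app \<Omega> Y (\<lambda>y. F (jet_of \<Omega> X u y)) x =
    (\<Sum>k\<in>UNIV. Y x $ k * F_x F k (jet_of \<Omega> X u x)) + vf_app \<Omega> Y u x * F_z F (jet_of \<Omega> X u x)
    + (\<Sum>i\<in>UNIV. vf_app \<Omega> Y (vf_app \<Omega> (X i) u) x * F_p F (jet_of \<Omega> X u x) $ i)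
    + (\<Sum>i\<in>UNIV. \<Sum>j\<in>UNIV. vf_app \<Omega> Y (vf_app \<Omega> (X j) (vf_app \<Omega> (X i) u)) x
        * F_r F i j (jet_of \<Omega> X u x))"
proof -
  let ?J = "jet_of \<Omega> X u"
  define F' where "F' = frechet_derivative F (at (?J x))"
  have F': "(F has_derivative F') (at (?J x))"
    using F by (simp add: F'_def frechet_derivative_works)
  define u' where "u' = frechet_derivative u (at x)"
  define g where "g i = frechet_derivative (vf_app \<Omega> (X i) u) (at x)" for i
  define h where "h i j = frechet_derivative (vf_app \<Omega> (X j) (vf_app \<Omega> (X i) u)) (at x)" for i j
  have d: "(u has_derivative u') (at x)"
    "\<And>i. (vf_app \<Omega> (X i) u has_derivative g i) (at x)"
    "\<And>i j. (vf_app \<Omega> (X j) (vf_app \<Omega> (X i) u) has_derivative h i j) (at x)"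
    using u Xu XXu by (simp_all add: u'_def g_def h_def frechet_derivative_works)
  \<comment> \<open>Expanded in the standard bases, the jet can be differentiated by the sum rule.\<close>
  have J: "?J = (\<lambda>y. (y, u y, (\<Sum>i\<in>UNIV. vf_app \<Omega> (X i) u y *\<^sub>R axis i 1),
      (\<Sum>i\<in>UNIV. \<Sum>j\<in>UNIV. vf_app \<Omega> (X j) (vf_app \<Omega> (X i) u) y *\<^sub>R axis i (axis j 1))))"
    by (auto simp: fun_eq_iff jet_of_def X_grad_def X_hessian_def vec_eq_iff axis_def
        if_distrib sum.If_cases if_distribR cong: if_cong)
  have J': "(?J has_derivative (\<lambda>v. (v, u' v, (\<Sum>i\<in>UNIV. g i v *\<^sub>R axis i 1),
      (\<Sum>i\<in>UNIV. \<Sum>j\<in>UNIV. h i j v *\<^sub>R axis i (axis j 1))))) (at x)"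
    unfolding J by (intro derivative_intros d)
  have lin: "linear F'" using F' has_derivative_linear by blast
  have l1: "linear (\<lambda>a. F' (a, 0, 0, 0))"
    by (rule linear_compose[OF _ lin, unfolded o_def]) (auto intro!: linearI)
  have l2: "linear (\<lambda>b. F' (0, b, 0, 0))"
    by (rule linear_compose[OF _ lin, unfolded o_def]) (auto intro!: linearI)
  have l3: "linear (\<lambda>c. F' (0, 0, c, 0))"
    by (rule linear_compose[OF _ lin, unfolded o_def]) (auto intro!: linearI)
  have l4: "linear (\<lambda>c. F' (0, 0, 0, c))"
    by (rule linear_compose[OF _ lin, unfolded o_def]) (auto intro!: linearI)
  have split: "F' (a, b, c, e) = F' (a, 0, 0, 0) + F' (0, b, 0, 0) + F' (0, 0, c, 0) + F' (0, 0, 0, e)"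
    for a b c e
    using linear_add[OF lin, symmetric] by simp
  have 1: "F' (a, 0, 0, 0) = (\<Sum>k\<in>UNIV. a $ k * F_x F k (?J x))" for a
  proof -
    have "F' (a, 0, 0, 0) = F' (\<Sum>k\<in>UNIV. a $ k *\<^sub>R axis k 1, 0, 0, 0)"
      by (rule arg_cong[where f = "\<lambda>a. F' (a, 0, 0, 0)", OF vec_expansion])
    also have "\<dots> = (\<Sum>k\<in>UNIV. a $ k * F' (axis k 1, 0, 0, 0))"
      by (simp add: linear_sum[OF l1] linear_scale[OF l1])
    finally show ?thesis by (simp add: F_x_def F'_def)
  qed
  have 2: "F' (0, b, 0, 0) = b * F_z F (?J x)" for b
    using linear_scale[OF l2, of b 1] by (simp add: F_z_def F'_def)
  have 3: "F' (0, 0, \<Sum>i\<in>UNIV. c i *\<^sub>R axis i 1, 0) = (\<Sum>i\<in>UNIV. c i * F_p F (?J x) $ i)" for c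
    by (simp add: linear_sum[OF l3] linear_scale[OF l3] F_p_def F'_def[symmetric])
  have 4: "F' (0, 0, 0, \<Sum>i\<in>UNIV. \<Sum>j\<in>UNIV. c i j *\<^sub>R axis i (axis j 1)) =
      (\<Sum>i\<in>UNIV. \<Sum>j\<in>UNIV. c i j * F_r F i j (?J x))" for c
    by (simp add: linear_sum[OF l4] linear_scale[OF l4] F_r_def F'_def[symmetric])
  have "vf_app \<Omega> Y (\<lambda>y. F (?J y)) x = F' (Y x, u' (Y x), (\<Sum>i\<in>UNIV. g i (Y x) *\<^sub>R axis i 1),
      (\<Sum>i\<in>UNIV. \<Sum>j\<in>UNIV. h i j (Y x) *\<^sub>R axis i (axis j 1)))"
    using vf_app_eqI[OF _ x] diff_chain_at[OF J' F'] by (simp add: o_def)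
  then show ?thesis
    unfolding split[of "Y x"] 1 2 3 4 vf_app_eqI[OF d(1) x] vf_app_eqI[OF d(2) x] vf_app_eqI[OF d(3) x]
    by simp
qed

lemma closure_jet_domain: "closure (jet_domain \<Omega>) = jet_domain (closure \<Omega>)"
  by (simp add: jet_domain_def closure_Times)

lemma open_jet_domain: "open \<Omega> \<Longrightarrow> open (jet_domain \<Omega>)"
  by (simp add: jet_domain_def open_Times)

lemma jet_of_mem [simp]: "jet_of \<Omega> X u x \<in> jet_domain S \<longleftrightarrow> x \<in> S"
  by (simp add: jet_of_def jet_domain_def)

lemma Ck_closure_jet:
  fixes X :: "'m::finite \<Rightarrow> real^'n \<Rightarrow> real^'n"
  assumes "open \<Omega>" and u: "Ck_closure (Suc (Suc k)) \<Omega> u" and X: "\<And>i. smooth_vf (X i)"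
    and c: "c \<in> Basis"
  shows "Ck_closure k \<Omega> (\<lambda>x. jet_of \<Omega> X u x \<bullet> c)"
proof -
  note vf = Ck_closure_vf_app[OF \<open>open \<Omega>\<close> _ smooth_vf_Ck_closure[OF \<open>open \<Omega>\<close> X]]
  have "Ck_closure k \<Omega> u" using u by (blast intro: Ck_closure_SucD)
  moreover have "Ck_closure k \<Omega> (vf_app \<Omega> (X i) u)" for i
    using vf[OF u] by (blast intro: Ck_closure_SucD)
  moreover have "Ck_closure k \<Omega> (vf_app \<Omega> (X j) (vf_app \<Omega> (X i) u))" for i j
    using vf[OF vf[OF u]] .
  moreover have "Ck_closure k \<Omega> (\<lambda>x. x $ l)" for l
    by (intro Ck_closure_linear \<open>open \<Omega>\<close> bounded_linear_vec_nth)
  ultimately show ?thesis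
    using c by (auto simp: Basis_prod_def Basis_vec_def jet_of_def X_grad_def X_hessian_def
        inner_axis Ck_closure_const \<open>open \<Omega>\<close>)
qed

lemma Ck_closure_jet_compose:
  fixes X :: "'m::finite \<Rightarrow> real^'n \<Rightarrow> real^'n"
  assumes "open \<Omega>" "Ck_closure k (jet_domain \<Omega>) f" "Ck_closure (Suc (Suc k)) \<Omega> u"
    "\<And>i. smooth_vf (X i)"
  shows "Ck_closure k \<Omega> (\<lambda>x. f (jet_of \<Omega> X u x))"
proof (rule Ck_closure_compose[of _ "jet_domain \<Omega>"])
  fix c :: "('n, 'm) jet"
  assume "c \<in> Basis"
  then show "Ck_closure k \<Omega> (\<lambda>x. jet_of \<Omega> X u x \<bullet> c)"
    using assms by (intro Ck_closure_jet)
qed (use assms open_jet_domain in auto)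

section \<open>The divergence theorem for multiples of a vector field\<close>

lemma set_integral_sum_real:
  fixes f :: "'i \<Rightarrow> 'a \<Rightarrow> real"
  assumes "\<And>i. i \<in> I \<Longrightarrow> set_integrable M A (f i)"
  shows "set_integrable M A (\<lambda>x. \<Sum>i\<in>I. f i x)"
    and "(LINT x:A|M. (\<Sum>i\<in>I. f i x)) = (\<Sum>i\<in>I. LINT x:A|M. f i x)"
  using assms unfolding set_integrable_def set_lebesgue_integral_def
  by (simp_all add: sum_distrib_left)

lemma continuous_on_closure_set_integrable:
  fixes f :: "'a::euclidean_space \<Rightarrow> real"
  assumes "open \<Omega>" "bounded \<Omega>" "continuous_on (closure \<Omega>) f"
  shows "set_integrable lborel \<Omega> f"
proof (rule set_integrable_subset)
  show "set_integrable lborel (closure \<Omega>) f"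
    unfolding set_integrable_def using assms by (intro borel_integrable_compact) auto
qed (use assms closure_subset in auto)

text \<open>
  The divergence theorem for the field \<open>f Y\<close>, where \<open>Y\<close> has constant divergence \<open>d\<close>.
\<close>

lemma divergence_theorem_vf:
  assumes "open \<Omega>" and reg: "regular_for_divergence_theorem (\<Omega> :: (real^'n) set)"
    and f: "Ck_closure 1 \<Omega> f" and Y: "\<And>k. Ck_closure 1 \<Omega> (\<lambda>x. Y x $ k)"
    and div: "\<And>x. x \<in> \<Omega> \<Longrightarrow> (\<Sum>k\<in>UNIV. dderiv \<Omega> (axis k 1) (\<lambda>y. Y y $ k) x) = d"
  shows "set_integrable (hausdorff_measure (CARD('n) - 1)) (frontier \<Omega>)
      (\<lambda>x. f x * (Y x \<bullet> outward_normal \<Omega> x))" (is ?int)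
    and "(LINT x:\<Omega>|lborel. vf_app \<Omega> Y f x + d * f x) =
    (LINT x:frontier \<Omega>|hausdorff_measure (CARD('n) - 1). f x * (Y x \<bullet> outward_normal \<Omega> x))" (is ?eq)
proof -
  define V where "V x = f x *\<^sub>R Y x" for x
  have V: "Ck_closure 1 \<Omega> (\<lambda>x. V x $ k)" for k
    using Ck_closure_mult[OF \<open>open \<Omega>\<close> f Y[of k]] by (simp add: V_def)
  have "(\<Sum>k\<in>UNIV. dderiv \<Omega> (axis k 1) (\<lambda>y. V y $ k) x) = vf_app \<Omega> Y f x + d * f x"
    if x: "x \<in> \<Omega>" for x
  proof -
    have "dderiv \<Omega> (axis k 1) (\<lambda>y. V y $ k) x =
        f x * dderiv \<Omega> (axis k 1) (\<lambda>y. Y y $ k) x + dderiv \<Omega> (axis k 1) f x * Y x $ k" for k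
    proof -
      have "f differentiable at x" "(\<lambda>y. Y y $ k) differentiable at x"
        using f Y[of k] x by simp_all
      then have "((\<lambda>y. f y * Y y $ k) has_derivative
          (\<lambda>h. f x * frechet_derivative (\<lambda>y. Y y $ k) (at x) h
              + frechet_derivative f (at x) h * Y x $ k)) (at x)"
        by (intro has_derivative_mult) (auto simp: frechet_derivative_works)
      then show ?thesis
        using x by (simp add: V_def dderiv_eqI dderiv_inside[of _ _ _ f]
            dderiv_inside[of _ _ _ "\<lambda>y. Y y $ k"])
    qed
    then show ?thesis
      using div[OF x]
      by (simp add: sum.distrib sum_distrib_left[symmetric] vf_app_def mult.commute)
  qed
  then have "(LINT x:\<Omega>|lborel. vf_app \<Omega> Y f x + d * f x) =
      (LINT x:\<Omega>|lborel. (\<Sum>k\<in>UNIV. dderiv \<Omega> (axis k 1) (\<lambda>y. V y $ k) x))"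
    using \<open>open \<Omega>\<close> by (intro set_lebesgue_integral_cong) auto
  also have "\<dots> = (LINT x:frontier \<Omega>|hausdorff_measure (CARD('n) - 1). V x \<bullet> outward_normal \<Omega> x)"
    using reg V unfolding regular_for_divergence_theorem_def by blast
  finally show ?eq by (simp add: V_def)
  have "set_integrable (hausdorff_measure (CARD('n) - 1)) (frontier \<Omega>)
      (\<lambda>x. V x \<bullet> outward_normal \<Omega> x)"
    using reg V unfolding regular_for_divergence_theorem_def by blast
  then show ?int by (simp add: V_def)
qed

section \<open>The integral identity\<close>

theorem proposition4p3:
  fixes X :: "'m::finite \<Rightarrow> real^'n::{finite,linorder} \<Rightarrow> real^'n::{finite,linorder}"
    and \<sigma> :: "'n::{finite,linorder} \<Rightarrow> nat"
    and \<Omega> :: "(real^'n::{finite,linorder}) set"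
    and F :: "(real^'n::{finite,linorder}) \<times> real \<times> (real^'m) \<times> (real^'m^'m) \<Rightarrow> real"
    and u :: "real^'n::{finite,linorder} \<Rightarrow> real"
  assumes smooth_X: "\<And>i. smooth_vf (X i)"
    and indep: "vf_lin_indep X"
    and H1: "dilation_exponents \<sigma>" "homogeneous_vfs \<sigma> X"
    and H2: "hoermander_at_0 X"
    and Omega: "open \<Omega>" "bounded \<Omega>" "regular_for_divergence_theorem \<Omega>"
    and P1: "\<exists>U. open U \<and> closure (jet_domain \<Omega>) \<subseteq> U \<and> Ck_on 1 U F"
    and P2: "\<And>i. Ck_closure 1 (jet_domain \<Omega>) (\<lambda>w. F_p F w $ i)"
    and P3: "\<And>i j. Ck_closure 2 (jet_domain \<Omega>) (F_r F i j)"
    and u: "Ck_closure 4 \<Omega> u"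
  shows
    "let q = real (\<Sum>k\<in>UNIV. \<sigma> k);
         J = jet_of \<Omega> X u;
         T = euler_vf \<sigma>;
         Tu = vf_app \<Omega> T u;
         \<nu> = outward_normal \<Omega>;
         H = hausdorff_measure (CARD('n) - 1)
     in
      (LINT x:\<Omega>|lborel. q * F (J x) - F_p F (J x) \<bullet> X_grad \<Omega> X u x)
      + (LINT x:\<Omega>|lborel. (\<Sum>k\<in>UNIV. real (\<sigma> k) * x $ k * F_x F k (J x)))
      + (LINT x:\<Omega>|lborel. Tu x *
          (X_div \<Omega> X (\<lambda>y. F_p F (J y)) x
           + (\<Sum>i\<in>UNIV. \<Sum>j\<in>UNIV. vf_app \<Omega> (X i) (vf_app \<Omega> (X j) (\<lambda>y. F_r F i j (J y))) x)
           + F_z F (J x)))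
      - 2 * (\<Sum>i\<in>UNIV. \<Sum>j\<in>UNIV.
          (LINT x:\<Omega>|lborel. F_r F i j (J x) * vf_app \<Omega> (X j) (vf_app \<Omega> (X i) u) x))
      = (LINT x:frontier \<Omega>|H. F (J x) * (T x \<bullet> \<nu> x))
        - (LINT x:frontier \<Omega>|H. Tu x * (F_p F (J x) \<bullet> X_normal X \<nu> x))
        + (\<Sum>i\<in>UNIV. \<Sum>j\<in>UNIV.
            (LINT x:frontier \<Omega>|H.
              (vf_app \<Omega> (X i) (\<lambda>y. F_r F j i (J y)) x * Tu x
               - F_r F i j (J x) * vf_app \<Omega> (X i) Tu x) * (X j x \<bullet> \<nu> x)))"
proof -
  note op = \<open>open \<Omega>\<close>
  define q where "q = real (\<Sum>k\<in>UNIV. \<sigma> k)"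
  define J where "J = jet_of \<Omega> X u"
  define T where "T = euler_vf \<sigma>"
  define Tu where "Tu = vf_app \<Omega> T u"
  define \<nu> where "\<nu> = outward_normal \<Omega>"
  define H where "H = (hausdorff_measure (CARD('n) - 1) :: (real^'n::{finite,linorder}) measure)"
  define A where "A i x = F_p F (J x) $ i" for i x
  define B where "B i j x = F_r F i j (J x)" for i j x
  define X' where "X' i = vf_app \<Omega> (X i)" for i
  define W where "W i j x = X' i (B j i) x * Tu x - B i j x * X' i Tu x" for i j x

  \<comment> \<open>Four derivatives of \<open>u\<close> make the jet \<open>J\<close> of class \<open>C\<^sup>2\<close> up to the boundary, as needed for the
    coefficients \<open>B i j\<close>, which are differentiated twice.\<close>
  have u4: "Ck_closure (Suc (Suc (Suc (Suc 0)))) \<Omega> u"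
    using u by (simp add: numeral_eq_Suc)
  have T: "Ck_closure k \<Omega> (\<lambda>x. T x $ l)" for k l
    unfolding T_def euler_vf_coordinate
    by (intro Ck_closure_linear op bounded_linear_const_mult bounded_linear_vec_nth)
  have X: "Ck_closure k \<Omega> (\<lambda>x. X i x $ l)" for k i l
    by (rule smooth_vf_Ck_closure[OF op smooth_X])
  have X': "Ck_closure k \<Omega> (X' i f)" if "Ck_closure (Suc k) \<Omega> f" for k i f
    unfolding X'_def by (rule Ck_closure_vf_app[OF op that X])
  have T': "Ck_closure k \<Omega> (vf_app \<Omega> T f)" if "Ck_closure (Suc k) \<Omega> f" for k f
    by (rule Ck_closure_vf_app[OF op that T])
  have Tu: "Ck_closure (Suc (Suc (Suc 0))) \<Omega> Tu"
    unfolding Tu_def by (rule T'[OF u4])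
  have Xu: "Ck_closure (Suc (Suc (Suc 0))) \<Omega> (X' i u)" for i
    by (rule X'[OF u4])
  have XXu: "Ck_closure (Suc (Suc 0)) \<Omega> (X' j (X' i u))" for i j
    by (rule X'[OF Xu])
  have A: "Ck_closure (Suc 0) \<Omega> (A i)" for i
    unfolding A_def[abs_def] J_def
    by (rule Ck_closure_jet_compose[OF op _ _ smooth_X])
       (use P2[of i] Ck_closure_SucD[OF u4] in simp_all)
  have B: "Ck_closure (Suc (Suc 0)) \<Omega> (B i j)" for i j
    unfolding B_def[abs_def] J_def
    by (rule Ck_closure_jet_compose[OF op _ u4 smooth_X])
       (use P3[of i j] in \<open>simp only: numeral_2_eq_2\<close>)
  obtain U where U: "open U" "closure (jet_domain \<Omega>) \<subseteq> U" and FU: "Ck_on (Suc 0) U F"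
    using P1 by auto
  have FJ: "Ck_closure (Suc 0) \<Omega> (\<lambda>x. F (J x))"
    unfolding J_def
    by (rule Ck_closure_jet_compose[OF op Ck_on_imp_Ck_closure _ smooth_X])
       (use FU U op open_jet_domain Ck_closure_SucD[OF u4] in auto)
  have contJ: "continuous_on (closure \<Omega>) J"
    unfolding J_def
    by (rule continuous_on_componentwise_inner)
       (rule Ck_closure_continuous[OF Ck_closure_jet[OF op u4 smooth_X]])
  have JU: "J x \<in> U" if "x \<in> closure \<Omega>" for x
    using U that by (auto simp: J_def closure_jet_domain)
  have FdJ: "continuous_on (closure \<Omega>) (\<lambda>x. frechet_derivative F (at (J x)) b)" if "b \<in> Basis" for b
    by (rule continuous_on_compose2[of U]) (use FU that contJ JU in auto)
  have Fx: "continuous_on (closure \<Omega>) (\<lambda>x. F_x F k (J x))" for k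
    unfolding F_x_def by (rule FdJ) (simp add: Basis_prod_def zero_prod_def image_iff)
  have Fz: "continuous_on (closure \<Omega>) (\<lambda>x. F_z F (J x))"
    unfolding F_z_def by (rule FdJ) (simp add: Basis_prod_def zero_prod_def image_iff)
  have diff: "f differentiable at x" if "Ck_closure (Suc k) \<Omega> f" "x \<in> \<Omega>" for f k x
    using that by simp
  have cont: "continuous_on (closure \<Omega>) f" if "Ck_closure k \<Omega> f" for f k
    using that by (rule Ck_closure_continuous)
  have W: "Ck_closure (Suc 0) \<Omega> (W i j)" for i j
    unfolding W_def[abs_def]
    by (intro Ck_closure_diff Ck_closure_mult op X' B Ck_closure_SucD[OF Tu] Ck_closure_SucD[OF B]
        Ck_closure_SucD[OF Ck_closure_SucD[OF Tu]] Tu)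
  have ATu: "Ck_closure (Suc 0) \<Omega> (\<lambda>x. A i x * Tu x)" for i
    by (intro Ck_closure_mult op A Ck_closure_SucD[OF Ck_closure_SucD[OF Tu]])

  \<comment> \<open>The three kinds of fields are \<open>F(J) T\<close>, \<open>A\<^sub>i Tu X\<^sub>i\<close> and \<open>W\<^sub>i\<^sub>j X\<^sub>j\<close>.
    The fields \<open>X\<^sub>i\<close> are divergence-free and \<open>T\<close> has the constant divergence \<open>q\<close>.\<close>
  have divX: "(\<Sum>k\<in>UNIV. dderiv \<Omega> (axis k 1) (\<lambda>y. X i y $ k) x) = 0" if "x \<in> \<Omega>" for i x
    using that homogeneous_vfs_divergence_free[OF H1(2) smooth_X] by (simp add: dderiv_inside)
  note divergence = divergence_theorem_vf[OF op Omega(3), folded H_def \<nu>_def, unfolded One_nat_def]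
  have E1: "(LINT x:\<Omega>|lborel. vf_app \<Omega> T (\<lambda>x. F (J x)) x + q * F (J x)) =
      (LINT x:frontier \<Omega>|H. F (J x) * (T x \<bullet> \<nu> x))"
    unfolding q_def by (rule divergence(2)[OF FJ T]) (simp add: T_def euler_vf_divergence)
  have E2: "(LINT x:\<Omega>|lborel. X' i (\<lambda>x. A i x * Tu x) x) =
      (LINT x:frontier \<Omega>|H. A i x * Tu x * (X i x \<bullet> \<nu> x))"
    "set_integrable H (frontier \<Omega>) (\<lambda>x. A i x * Tu x * (X i x \<bullet> \<nu> x))" for i
    using divergence[OF ATu X divX] by (simp_all add: X'_def)
  have E3: "(LINT x:\<Omega>|lborel. X' j (W i j) x) = (LINT x:frontier \<Omega>|H. W i j x * (X j x \<bullet> \<nu> x))" for i j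
    using divergence(2)[OF W X divX] by (simp add: X'_def)
  have AX: "(\<Sum>i\<in>UNIV. A i x * Tu x * (X i x \<bullet> \<nu> x)) = Tu x * (F_p F (J x) \<bullet> X_normal X \<nu> x)" for x
    by (simp add: inner_vec_def[of "F_p F (J x)"] X_normal_def A_def sum_distrib_left mult_ac)
  have E2': "(\<Sum>i\<in>UNIV. LINT x:\<Omega>|lborel. X' i (\<lambda>x. A i x * Tu x) x) =
      (LINT x:frontier \<Omega>|H. Tu x * (F_p F (J x) \<bullet> X_normal X \<nu> x))"
    unfolding E2(1) AX[symmetric] by (rule set_integral_sum_real(2)[symmetric]) (rule E2(2))

  define I1 where "I1 x = q * F (J x) - F_p F (J x) \<bullet> X_grad \<Omega> X u x" for x
  define I2 where "I2 x = (\<Sum>k\<in>UNIV. real (\<sigma> k) * x $ k * F_x F k (J x))" for x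
  define I3 where "I3 x = Tu x * (X_div \<Omega> X (\<lambda>y. F_p F (J y)) x
           + (\<Sum>i\<in>UNIV. \<Sum>j\<in>UNIV. vf_app \<Omega> (X i) (vf_app \<Omega> (X j) (\<lambda>y. F_r F i j (J y))) x)
           + F_z F (J x))" for x
  define I4 where "I4 i j x = F_r F i j (J x) * vf_app \<Omega> (X j) (vf_app \<Omega> (X i) u) x" for i j x
  have I1: "I1 x = q * F (J x) - (\<Sum>i\<in>UNIV. A i x * X' i u x)" for x
    by (simp add: I1_def A_def X'_def X_grad_def inner_vec_def)
  have I3: "I3 x = Tu x * (- (\<Sum>i\<in>UNIV. X' i (A i) x) + (\<Sum>i\<in>UNIV. \<Sum>j\<in>UNIV. X' i (X' j (B i j)) x)
      + F_z F (J x))" for x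
    by (simp add: I3_def A_def[abs_def] B_def[abs_def] X'_def X_div_def)
  have I4: "I4 i j x = B i j x * X' j (X' i u) x" for i j x
    by (simp add: I4_def B_def X'_def)

  \<comment> \<open>The two sides agree only after summation over \<open>i\<close> and \<open>j\<close>: the products of first
    derivatives in \<open>X\<^sub>j W\<^sub>i\<^sub>j\<close> cancel, and the second derivatives of \<open>B\<close> match, after exchanging the
    two indices.\<close>
  have pointwise: "I1 x + I2 x + I3 x - 2 * (\<Sum>i\<in>UNIV. \<Sum>j\<in>UNIV. I4 i j x) =
      (vf_app \<Omega> T (\<lambda>x. F (J x)) x + q * F (J x)) - (\<Sum>i\<in>UNIV. X' i (\<lambda>x. A i x * Tu x) x)
      + (\<Sum>i\<in>UNIV. \<Sum>j\<in>UNIV. X' j (W i j) x)"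
    if x: "x \<in> \<Omega>" for x
  proof -
    have comm: "vf_app \<Omega> T (X' i v) y = X' i (vf_app \<Omega> T v) y - X' i v y"
      if "Ck_closure (Suc (Suc 0)) \<Omega> v" "y \<in> \<Omega>" for i v y
      using vf_app_commute_euler[OF H1(2) smooth_X op that(2)] that(1)
      by (simp add: X'_def T_def numeral_2_eq_2)
    have TX: "vf_app \<Omega> T (X' i u) y = X' i Tu y - X' i u y" if "y \<in> \<Omega>" for i y
      unfolding Tu_def by (rule comm[OF Ck_closure_SucD[OF Ck_closure_SucD[OF u4]] that])
    have TXX: "vf_app \<Omega> T (X' j (X' i u)) x = X' j (X' i Tu) x - 2 * X' j (X' i u) x" for i j
    proof -
      have "X' j (vf_app \<Omega> T (X' i u)) x = X' j (\<lambda>y. X' i Tu y - X' i u y) x"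
        using dderiv_cong[OF op TX] by (simp add: X'_def vf_app_def[of \<Omega> "X j"])
      also have "\<dots> = X' j (X' i Tu) x - X' j (X' i u) x"
        unfolding X'_def[of j]
        by (rule vf_app_diff[OF diff[OF X'[OF Tu] x] diff[OF Xu x] x])
      finally show ?thesis
        using comm[OF Ck_closure_SucD[OF Xu] x] by simp
    qed
    have TF: "vf_app \<Omega> T (\<lambda>x. F (J x)) x = I2 x + Tu x * F_z F (J x)
        + (\<Sum>i\<in>UNIV. (X' i Tu x - X' i u x) * A i x)
        + (\<Sum>i\<in>UNIV. \<Sum>j\<in>UNIV. (X' j (X' i Tu) x - 2 * X' j (X' i u) x) * B i j x)"
    proof -
      have "F differentiable at (J x)"
        using FU JU x closure_subset by auto
      then show ?thesis
        using vf_app_jet[OF x, of F X u T] diff[OF u4 x] diff[OF Xu x] diff[OF XXu x]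
        by (simp add: J_def[symmetric] X'_def[symmetric] Tu_def[symmetric] TX[OF x] TXX
            I2_def A_def B_def) (simp add: T_def euler_vf_def)
    qed
    have DA: "X' i (\<lambda>x. A i x * Tu x) x = A i x * X' i Tu x + X' i (A i) x * Tu x" for i
      unfolding X'_def by (rule vf_app_mult[OF diff[OF A x] diff[OF Tu x] x])
    have DW: "X' j (W i j) x = X' i (B j i) x * X' j Tu x + X' j (X' i (B j i)) x * Tu x
        - (B i j x * X' j (X' i Tu) x + X' j (B i j) x * X' i Tu x)" for i j
    proof -
      note d = diff[OF X'[OF B] x] diff[OF Tu x] diff[OF B x] diff[OF X'[OF Tu] x]
      have "X' j (W i j) x =
          X' j (\<lambda>x. X' i (B j i) x * Tu x) x - X' j (\<lambda>x. B i j x * X' i Tu x) x"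
        unfolding W_def[abs_def] X'_def[of j]
        by (rule vf_app_diff) (use d x in \<open>auto intro!: differentiable_mult\<close>)
      also have "X' j (\<lambda>x. X' i (B j i) x * Tu x) x =
          X' i (B j i) x * X' j Tu x + X' j (X' i (B j i)) x * Tu x"
        unfolding X'_def[of j] by (rule vf_app_mult) (use d x in auto)
      also have "X' j (\<lambda>x. B i j x * X' i Tu x) x =
          B i j x * X' j (X' i Tu) x + X' j (B i j) x * X' i Tu x"
        unfolding X'_def[of j] by (rule vf_app_mult) (use d x in auto)
      finally show ?thesis .
    qed
    have s1: "(\<Sum>i\<in>UNIV. \<Sum>j\<in>UNIV. X' i (B j i) x * X' j Tu x) =
        (\<Sum>i\<in>UNIV. \<Sum>j\<in>UNIV. X' j (B i j) x * X' i Tu x)"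
      by (rule sum.swap)
    have s2: "(\<Sum>i\<in>UNIV. \<Sum>j\<in>UNIV. X' j (X' i (B j i)) x * Tu x) =
        (\<Sum>i\<in>UNIV. \<Sum>j\<in>UNIV. X' i (X' j (B i j)) x * Tu x)"
      by (rule sum.swap)
    show ?thesis
      unfolding I1 I3 I4 TF DA DW
      using s1 s2
      by (simp add: sum.distrib sum_subtractf algebra_simps sum_distrib_left sum_distrib_right)
  qed

  \<comment> \<open>All terms are continuous on the compact closure of \<open>\<Omega>\<close>, so the integral may be split on both
    sides of the pointwise identity.\<close>
  note int = continuous_on_closure_set_integrable[OF Omega(1,2)]
  note cX' = cont[OF X']
  have i1: "set_integrable lborel \<Omega> I1"
    by (rule int) (auto simp: I1[abs_def] intro!: continuous_intros cont[OF A] cont[OF FJ] cont[OF Xu])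
  have i2: "set_integrable lborel \<Omega> I2"
    by (rule int) (auto simp: I2_def[abs_def] intro!: continuous_intros Fx)
  have i3: "set_integrable lborel \<Omega> I3"
    by (rule int) (auto simp: I3[abs_def] intro!: continuous_intros cX'[OF A] Fz cont[OF Tu] cX'[OF X'[OF B]])
  have i4: "set_integrable lborel \<Omega> (I4 i j)" for i j
    by (rule int) (auto simp: I4[abs_def] intro!: continuous_intros cont[OF XXu] cont[OF B])
  have j1: "set_integrable lborel \<Omega> (\<lambda>x. vf_app \<Omega> T (\<lambda>x. F (J x)) x + q * F (J x))"
    by (rule int) (auto intro!: continuous_intros cont[OF T'[OF FJ]] cont[OF FJ])
  have j2: "set_integrable lborel \<Omega> (X' i (\<lambda>x. A i x * Tu x))" for i
    by (rule int[OF cX'[OF ATu]])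
  have j3: "set_integrable lborel \<Omega> (X' j (W i j))" for i j
    by (rule int[OF cX'[OF W]])
  note sums = set_integral_sum_real

  have "(LINT x:\<Omega>|lborel. I1 x) + (LINT x:\<Omega>|lborel. I2 x) + (LINT x:\<Omega>|lborel. I3 x)
      - 2 * (\<Sum>i\<in>UNIV. \<Sum>j\<in>UNIV. LINT x:\<Omega>|lborel. I4 i j x) =
      (LINT x:\<Omega>|lborel. I1 x + I2 x + I3 x - 2 * (\<Sum>i\<in>UNIV. \<Sum>j\<in>UNIV. I4 i j x))"
    by (simp add: i1 i2 i3 i4 sums)
  also have "\<dots> = (LINT x:\<Omega>|lborel.
      (vf_app \<Omega> T (\<lambda>x. F (J x)) x + q * F (J x)) - (\<Sum>i\<in>UNIV. X' i (\<lambda>x. A i x * Tu x) x)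
      + (\<Sum>i\<in>UNIV. \<Sum>j\<in>UNIV. X' j (W i j) x))"
    by (rule set_lebesgue_integral_cong) (use op pointwise in auto)
  also have "\<dots> = (LINT x:\<Omega>|lborel. vf_app \<Omega> T (\<lambda>x. F (J x)) x + q * F (J x))
      - (\<Sum>i\<in>UNIV. LINT x:\<Omega>|lborel. X' i (\<lambda>x. A i x * Tu x) x)
      + (\<Sum>i\<in>UNIV. \<Sum>j\<in>UNIV. LINT x:\<Omega>|lborel. X' j (W i j) x)"
    by (simp add: j1 j2 j3 sums)
  also have "\<dots> = (LINT x:frontier \<Omega>|H. F (J x) * (T x \<bullet> \<nu> x))
      - (LINT x:frontier \<Omega>|H. Tu x * (F_p F (J x) \<bullet> X_normal X \<nu> x))
      + (\<Sum>i\<in>UNIV. \<Sum>j\<in>UNIV. LINT x:frontier \<Omega>|H. W i j x * (X j x \<bullet> \<nu> x))"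
    unfolding E1 E2' E3 ..
  finally show ?thesis
    unfolding Let_def I1_def I2_def I3_def I4_def W_def B_def[abs_def] X'_def Tu_def T_def J_def
      q_def \<nu>_def H_def .
qed

end
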